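(* Let $b$ be a prime, let $s,m,\alpha,d\in\mathbb{N}$ with $\min(\alpha,d)>1$, and let $\boldsymbol{\gamma}=(\gamma_v)_{v\subseteq\{1:s\}}$ be non-negative real weights. Suppose $p\in\mathbb{F}_b[x]$ and $\boldsymbol{q}=(q_1,\ldots,q_{ds})$ are found by the component-by-component algorithm: $p$ is an irreducible polynomial with $\deg(p)=m$, $q_1=1$, and for $\tau=2,\ldots,ds$ successively, $q_\tau$ minimizes $B_{\alpha,d,\boldsymbol{\gamma},(1)}((q_1,\ldots,q_{\tau-1},\tilde q_\tau),p)$ as a function of $\tilde q_\tau\in\mathcal{R}_m$. Write $\boldsymbol{q}_\tau=(q_1,\ldots,q_\tau)$. Then for any $\tau=1,\ldots,ds$ and any real $\lambda$ with $1/\min(\alpha,d)<\lambda\le1$ we have $$B_{\alpha,d,\boldsymbol{\gamma},(1)}(\boldsymbol{q}_\tau,p)\le\frac1{(b^m-1)^{1/\lambda}}\left[\sum_{\emptyset\ne v\subseteq\{1:j_0-1\}}\tilde\gamma_v^\lambda G_{\alpha,d,\lambda,d,(1)}^{|v|}+G_{\alpha,d,\lambda,d_0,(1)}\sum_{v\subseteq\{1:j_0-1\}}\tilde\gamma_{v\cup\{j_0\}}^\lambda G_{\alpha,d,\lambda,d,(1)}^{|v|}\right]^{1/\lambda},$$ where $j_0=\lceil\tau/d\rceil$, $d_0=\tau-(j_0-1)d$, and for $a=1,\ldots,d$ $$G_{\alpha,d,\lambda,a,(1)}=-1+(1+\tilde G_{\alpha,d,\lambda,(1)})^a,\qquad \tilde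 G_{\alpha,d,\lambda,(1)}=\frac1{b^{\alpha\lambda/2}}\max\left\{\left(\frac{b-1}{b^{\min(\alpha,d)}-b}\right)^\lambda,\frac{b-1}{b^{\lambda\min(\alpha,d)}-b}\right\}.$$
   Context: $\{a:c\}=\{a,a+1,\ldots,c\}$ (empty if $c<a$). $\mathbb{F}_b$ is the field with $b$ elements, identified with $\{0,\ldots,b-1\}$. $\mathcal{R}_m=\{q\in\mathbb{F}_b[x]:\deg(q)<m,\ q\ne0\}$. A non-negative integer $n=\nu_0+\nu_1b+\cdots$ is identified with the polynomial $n(x)=\nu_0+\nu_1x+\cdots\in\mathbb{F}_b[x]$. $v_m(\sum_{l=w}^\infty t_lx^{-l})=\sum_{l=\max(1,w)}^mt_lb^{-l}$ for formal Laurent series over $\mathbb{F}_b$, and for a generating vector $(q_1,q_2,\ldots)$ and modulus $p$ with $\deg(p)=m$, $z_{n,j}=v_m(n(x)q_j(x)/p(x))\in[0,1)$ for $0\le n<b^m$. $\tilde\gamma_v=\gamma_vb^{\alpha(2d-1)|v|/2}$, and for $z\in[0,1)$ $$\phi_{\alpha,d,(1)}(z)=\frac{b-1-b^{(\min(\alpha,d)-1)\lfloor\log_bz\rfloor}(b^{\min(\alpha,d)}-1)}{b^{(\alpha+2)/2}(b^{\min(\alpha,d)-1}-1)},$$ where for $z=0$ one sets $b^{\lfloor\log_b0\rfloor}=0$. For $1\le\tau\le ds$, $j_0=\lceil\tau/d\rceil$, $d_0=\tau-(j_0-1)d$, and $\boldsymbol{q}_\tau=(q_1,\ldots,q_\tau)$,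 $$B_{\alpha,d,\boldsymbol{\gamma},(1)}(\boldsymbol{q}_\tau,p)=\frac1{b^m}\sum_{n=0}^{b^m-1}\sum_{\emptyset\ne v\subseteq\{1:j_0-1\}}\tilde\gamma_v\prod_{j\in v}\Phi_{n,j}+\frac1{b^m}\sum_{n=0}^{b^m-1}\sum_{v\subseteq\{1:j_0-1\}}\tilde\gamma_{v\cup\{j_0\}}\Big(\prod_{j\in v}\Phi_{n,j}\Big)\left[-1+\prod_{l=1}^{d_0}\left(1+\phi_{\alpha,d,(1)}(z_{n,(j_0-1)d+l})\right)\right],$$ where $\Phi_{n,j}=-1+\prod_{l=1}^d(1+\phi_{\alpha,d,(1)}(z_{n,(j-1)d+l}))$. (For $\tau=ds$ this quantity is an upper bound on the worst-case integration error, in the weighted Walsh space of smoothness $\alpha$ with weights $\boldsymbol{\gamma}$, of the interlaced polynomial lattice rule of order $d$ with generating vector $\boldsymbol{q}$ and modulus $p$.) *)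

theory Defs
  imports
    Complex_Main
    "HOL-Computational_Algebra.Formal_Laurent_Series"
    "Berlekamp_Zassenhaus.Finite_Field"
begin

hide_const (open) up_ring.monom up_ring.coeff

text \<open>
  The field with \<open>b\<close> elements (\<open>b\<close> prime) is \<open>'p mod_ring\<close> with \<open>'p :: prime_card\<close> and
  \<open>b = CARD('p)\<close>. It is identified with \<open>{0..b-1}\<close> by \<open>of_nat\<close> in one direction and by
  \<open>to_int_mod_ring\<close> in the other. Generating vectors \<open>q\<close> are 1-based.
\<close>

definition poly_range :: "nat \<Rightarrow> 'a::zero poly set" where
  "poly_range m = {q. q \<noteq> 0 \<and> degree q < m}"

text \<open>
  The polynomial whose coefficients are the base-\<open>b\<close> digits of \<open>n\<close>; since \<open>n < b ^ Suc n\<close>, the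
  digits of index greater than \<open>n\<close> vanish.
\<close>

definition poly_of_nat :: "nat \<Rightarrow> 'p::prime_card mod_ring poly" where
  "poly_of_nat n = (\<Sum>i\<le>n. monom (of_nat (n div CARD('p) ^ i mod CARD('p))) i)"

text \<open>
  Laurent series in \<open>x\<^sup>-\<^sup>1\<close>: the library's variable \<open>fls_X\<close> plays the role of \<open>x\<^sup>-\<^sup>1\<close>, hence
  \<open>fls_X_inv\<close> the role of \<open>x\<close>, and \<open>fls_nth f l\<close> is the coefficient of \<open>x\<^sup>-\<^sup>l\<close>.
\<close>

definition laurent_of_poly :: "'a::field poly \<Rightarrow> 'a fls" where
  "laurent_of_poly q = poly (map_poly fls_const q) fls_X_inv"

text \<open>
  The sum may start at \<open>l = 1\<close> rather than at the maximum of \<open>1\<close> and the first index \<open>w\<close> of the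
  series, because \<open>fls_nth\<close> is \<open>0\<close> below \<open>w\<close>.
\<close>

definition laurent_trunc :: "nat \<Rightarrow> 'p::prime_card mod_ring fls \<Rightarrow> real" where
  "laurent_trunc m f =
     (\<Sum>l=1..m. real_of_int (to_int_mod_ring (fls_nth f (int l))) / real CARD('p) ^ l)"

definition lattice_point ::
    "(nat \<Rightarrow> 'p::prime_card mod_ring poly) \<Rightarrow> 'p mod_ring poly \<Rightarrow> nat \<Rightarrow> nat \<Rightarrow> real" where
  "lattice_point q p n j =
     laurent_trunc (degree p)
       (laurent_of_poly (poly_of_nat n) * laurent_of_poly (q j) / laurent_of_poly p)"

definition weight_tilde ::
    "nat \<Rightarrow> nat \<Rightarrow> nat \<Rightarrow> (nat set \<Rightarrow> real) \<Rightarrow> nat set \<Rightarrow> real" where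
  "weight_tilde b \<alpha> d \<gamma> v =
     \<gamma> v * real b powr (real \<alpha> * (2 * real d - 1) * real (card v) / 2)"

definition pow_floor_log :: "nat \<Rightarrow> real \<Rightarrow> real" where
  "pow_floor_log b z = (if z = 0 then 0 else real b powi \<lfloor>log (real b) z\<rfloor>)"

text \<open>
  The natural-number subtraction below is not truncated, as the function is only used for
  \<open>min \<alpha> d > 1\<close>.
\<close>

definition phi :: "nat \<Rightarrow> nat \<Rightarrow> nat \<Rightarrow> real \<Rightarrow> real" where
  "phi b \<alpha> d z =
     (real b - 1 - pow_floor_log b z ^ (min \<alpha> d - 1) * (real b ^ min \<alpha> d - 1)) /
     (real b powr ((real \<alpha> + 2) / 2) * (real b ^ (min \<alpha> d - 1) - 1))"

definition block_index :: "nat \<Rightarrow> nat \<Rightarrow> nat" where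
  "block_index d \<tau> = nat \<lceil>real \<tau> / real d\<rceil>"

definition block_offset :: "nat \<Rightarrow> nat \<Rightarrow> nat" where
  "block_offset d \<tau> = \<tau> - (block_index d \<tau> - 1) * d"

text \<open>
  The value \<open>Phi_block \<alpha> d k q p n j\<close> uses only the first \<open>k\<close> of the \<open>d\<close> components that form the
  \<open>j\<close>-th block.
\<close>

definition Phi_block ::
    "nat \<Rightarrow> nat \<Rightarrow> nat \<Rightarrow> (nat \<Rightarrow> 'p::prime_card mod_ring poly) \<Rightarrow> 'p mod_ring poly
      \<Rightarrow> nat \<Rightarrow> nat \<Rightarrow> real" where
  "Phi_block \<alpha> d k q p n j =
     -1 + (\<Prod>l=1..k. 1 + phi CARD('p) \<alpha> d (lattice_point q p n ((j - 1) * d + l)))"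

definition B_crit ::
    "nat \<Rightarrow> nat \<Rightarrow> (nat set \<Rightarrow> real) \<Rightarrow> nat \<Rightarrow> (nat \<Rightarrow> 'p::prime_card mod_ring poly)
      \<Rightarrow> 'p mod_ring poly \<Rightarrow> real" where
  "B_crit \<alpha> d \<gamma> \<tau> q p =
     (let b = CARD('p); m = degree p; j0 = block_index d \<tau>; d0 = block_offset d \<tau> in
       1 / real b ^ m * (\<Sum>n<b ^ m. \<Sum>v\<in>Pow {1..j0 - 1} - {{}}.
         weight_tilde b \<alpha> d \<gamma> v * (\<Prod>j\<in>v. Phi_block \<alpha> d d q p n j)) +
       1 / real b ^ m * (\<Sum>n<b ^ m. \<Sum>v\<in>Pow {1..j0 - 1}.
         weight_tilde b \<alpha> d \<gamma> (v \<union> {j0}) * (\<Prod>j\<in>v. Phi_block \<alpha> d d q p n j) *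
           Phi_block \<alpha> d d0 q p n j0))"

text \<open>
  The value \<open>B_crit \<alpha> d \<gamma> \<tau> q p\<close> depends only on \<open>q 1, \<dots>, q \<tau>\<close>, so in step \<open>\<tau>\<close> of the
  component-by-component construction the later entries of \<open>q\<close> play no role.
\<close>

definition cbc_constructed ::
    "nat \<Rightarrow> nat \<Rightarrow> nat \<Rightarrow> (nat set \<Rightarrow> real) \<Rightarrow> nat \<Rightarrow> 'p::prime_card mod_ring poly
      \<Rightarrow> (nat \<Rightarrow> 'p mod_ring poly) \<Rightarrow> bool" where
  "cbc_constructed \<alpha> d s \<gamma> m p q \<longleftrightarrow>
     irreducible p \<and> degree p = m \<and> q 1 = 1 \<and>
     (\<forall>\<tau>\<in>{2..d * s}.
        is_arg_min (\<lambda>q'. B_crit \<alpha> d \<gamma> \<tau> (q(\<tau> := q')) p) (\<lambda>q'. q' \<in> poly_range m) (q \<tau>))"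

definition G_tilde :: "nat \<Rightarrow> nat \<Rightarrow> nat \<Rightarrow> real \<Rightarrow> real" where
  "G_tilde b \<alpha> d lam =
     1 / real b powr (real \<alpha> * lam / 2) *
     max (((real b - 1) / (real b ^ min \<alpha> d - real b)) powr lam)
         ((real b - 1) / (real b powr (lam * real (min \<alpha> d)) - real b))"

definition G_const :: "nat \<Rightarrow> nat \<Rightarrow> nat \<Rightarrow> real \<Rightarrow> nat \<Rightarrow> real" where
  "G_const b \<alpha> d lam a = -1 + (1 + G_tilde b \<alpha> d lam) ^ a"

end

theory Submission
  imports Defs
begin

text \<open>
  Since \<open>p\<close> is irreducible of degree \<open>m\<close>, the polynomials of degree less than \<open>m\<close> are the
  elements of a field with \<open>b\<^sup>m\<close> elements, and \<open>z\<^sub>n\<^sub>,\<^sub>j\<close> depends only on the residue of \<open>n q\<^sub>j\<close> modulo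
  \<open>p\<close>. As a function of this residue, \<open>\<phi>\<close> is a combination of the additive characters of the
  field with non-negative coefficients, the smallest of which belongs to the trivial character, and the
  sum of the \<open>\<lambda>\<close>-th powers of the coefficients is at most \<open>G_tilde\<close>.

  The sum of \<open>\<lambda>\<close>-th powers of coefficients is subadditive, submultiplicative (the coefficients of a
  product are a convolution) and invariant under multiplication of the argument by a unit, and the mean
  over all \<open>n\<close> is the coefficient of the trivial character. Adding component \<open>\<tau>\<close> increases the
  criterion by the mean of \<open>P \<sqdot> \<phi>\<close>, with \<open>P\<close> determined by the earlier components. By minimality,
  the \<open>\<lambda>\<close>-th power of this increment is at most its average over all choices of \<open>q\<^sub>\<tau>\<close>, and this
  average is controlled by the product of the two power sums. The bound follows by summing over \<open>\<tau>\<close>.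
\<close>

subsection \<open>Laurent coefficients and digits\<close>

text \<open>Zero is adjoined explicitly, as a condition on the degree alone would exclude it at
  \<open>a = 0\<close>. Thus \<open>poly_below 0\<close> contains just zero, and the cardinality
  \<open>b ^ a\<close> is right for every \<open>a\<close>.\<close>

definition poly_below :: "nat \<Rightarrow> 'a::zero poly set" where
  "poly_below a = insert 0 (poly_range a)"

text \<open>For \<open>degree p \<ge> 1\<close> this is the coefficient of \<open>x^(-1)\<close> in
  \<open>g / p\<close>: a linear functional on residues modulo \<open>p\<close>, through which
  digits and characters are both expressed.\<close>

definition residue_coeff :: "'a::field poly \<Rightarrow> 'a poly \<Rightarrow> 'a" where
  "residue_coeff p g = coeff (g mod p) (degree p - 1) / lead_coeff p"

lemma residue_coeff_add: "residue_coeff p (g + h) = residue_coeff p g + residue_coeff p h"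
  by (simp add: residue_coeff_def poly_mod_add_left add_divide_distrib)

lemma residue_coeff_smult: "residue_coeff p (Polynomial.smult c g) = c * residue_coeff p g"
  by (simp add: residue_coeff_def mod_smult_left)

lemma residue_coeff_0 [simp]: "residue_coeff p 0 = 0"
  by (simp add: residue_coeff_def)

lemma residue_coeff_sum: "residue_coeff p (sum f A) = (\<Sum>i\<in>A. residue_coeff p (f i))"
  by (induction A rule: infinite_finite_induct) (auto simp: residue_coeff_add)

lemma residue_coeff_mod [simp]: "residue_coeff p (g mod p) = residue_coeff p g"
  by (simp add: residue_coeff_def)

lemma residue_coeff_mult_mod [simp]:
  "residue_coeff p (f * (g mod p)) = residue_coeff p (f * g)"
  by (metis residue_coeff_mod mod_mult_right_eq)

lemma residue_coeff_mult:
  fixes k :: "'a::field poly"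
  assumes "k \<in> poly_below a"
  shows "residue_coeff p (k * g) = (\<Sum>i<a. coeff k i * residue_coeff p (monom 1 i * g))"
proof -
  have "k = (\<Sum>i<a. Polynomial.smult (coeff k i) (monom 1 i))"
    using assms by (intro poly_eqI)
      (auto simp: coeff_sum coeff_monom poly_below_def poly_range_def coeff_eq_0 if_distrib cong: if_cong)
  then have "k * g = (\<Sum>i<a. Polynomial.smult (coeff k i) (monom 1 i * g))"
    by (metis (no_types, lifting) sum_distrib_right mult_smult_left sum.cong)
  then show ?thesis
    by (simp add: residue_coeff_sum residue_coeff_smult)
qed

text \<open>The pairing of \<open>k\<close> and \<open>g\<close> by
  \<open>residue_coeff p (k * g)\<close> is nondegenerate modulo \<open>p\<close>: a suitable power
  of x lifts the nonzero remainder of \<open>g\<close> to degree exactly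
  \<open>degree p - 1\<close>, so no reduction occurs and its leading coefficient is read
  off.\<close>

lemma residue_coeff_nondegenerate:
  assumes "\<not> p dvd g" "p \<noteq> 0"
  shows "\<exists>i<degree p. residue_coeff p (monom 1 i * g) \<noteq> 0"
proof -
  define r where "r = g mod p"
  have r: "r \<noteq> 0" using assms by (auto simp: r_def dvd_eq_mod_eq_0)
  have dr: "degree r < degree p" 
    unfolding r_def by (rule degree_mod_less') (use assms r r_def in auto)
  define i where "i = degree p - 1 - degree r"
  have mi: "monom 1 i \<noteq> (0 :: 'a poly)" by simp
  have "degree (monom 1 i * r) = degree p - 1"
    using dr r mi by (subst degree_mult_eq) (auto simp: i_def degree_monom_eq)
  moreover have "(monom 1 i * r) mod p = monom 1 i * r"
    using calculation dr by (intro mod_poly_less) auto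
  moreover have "lead_coeff (monom 1 i * r) \<noteq> 0" using r mi by simp
  ultimately have "residue_coeff p (monom 1 i * r) \<noteq> 0"
    using assms by (auto simp: residue_coeff_def)
  then have "residue_coeff p (monom 1 i * g) \<noteq> 0"
    by (simp add: r_def)
  moreover have "i < degree p" using dr by (auto simp: i_def)
  ultimately show ?thesis by blast
qed

section \<open>Embedding of polynomials into Laurent series\<close>

lemma laurent_of_poly_pCons:
  "laurent_of_poly (pCons a q) = fls_const a + fls_X_inv * laurent_of_poly q"
  by (cases "a = 0 \<and> q = 0") (auto simp: laurent_of_poly_def map_poly_pCons)

lemma fls_nth_laurent_of_poly:
  "fls_nth (laurent_of_poly q) n = (if n \<le> 0 then coeff q (nat (- n)) else 0)"
proof (induction q arbitrary: n rule: pCons_induct)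
  case 0
  show ?case by (simp add: laurent_of_poly_def)
next
  case (pCons a q)
  then show ?case
    by (auto simp: laurent_of_poly_pCons fls_X_inv_times_conv_shift coeff_pCons nat_diff_distrib
        split: nat.splits)
qed

lemma laurent_of_poly_add: "laurent_of_poly (f + g) = laurent_of_poly f + laurent_of_poly g"
  by (rule fls_eqI) (simp add: fls_nth_laurent_of_poly)

lemma laurent_of_poly_smult: "laurent_of_poly (Polynomial.smult c g) = fls_const c * laurent_of_poly g"
  by (rule fls_eqI) (simp add: fls_nth_laurent_of_poly)

lemma laurent_of_poly_0 [simp]: "laurent_of_poly 0 = 0"
  by (simp add: laurent_of_poly_def)

lemma laurent_of_poly_mult: "laurent_of_poly (f * g) = laurent_of_poly f * laurent_of_poly g"
  by (induction f rule: pCons_induct)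
     (auto simp: laurent_of_poly_pCons laurent_of_poly_add laurent_of_poly_smult algebra_simps)

lemma laurent_of_poly_eq_0_iff [simp]: "laurent_of_poly q = 0 \<longleftrightarrow> q = 0"
proof
  assume *: "laurent_of_poly q = 0"
  show "q = 0"
  proof (rule poly_eqI)
    fix n show "coeff q n = coeff 0 n"
      using arg_cong[OF *, of "\<lambda>f. fls_nth f (- int n)"] by (simp add: fls_nth_laurent_of_poly)
  qed
qed simp

lemma laurent_of_poly_monom: "laurent_of_poly (monom 1 n) = fls_X_inv ^ n"
  by (rule fls_eqI) (auto simp: fls_nth_laurent_of_poly)

lemma subdegree_laurent_of_poly: "q \<noteq> 0 \<Longrightarrow> fls_subdegree (laurent_of_poly q) = - int (degree q)"
  by (rule fls_subdegree_eqI) (auto simp: fls_nth_laurent_of_poly intro: coeff_eq_0)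

text \<open>The part \<open>g div p\<close> has no negative powers of x. For a nonzero remainder
  \<open>r\<close>, the series of \<open>r / p\<close> starts at index
  \<open>degree p - degree r \<ge> 1\<close>, so index 1 is either its leading position or below
  it.\<close>

lemma fls_nth_1_divide_laurent_of_poly:
  fixes p :: "'a::field poly"
  assumes "degree p \<ge> 1"
  shows "fls_nth (laurent_of_poly g / laurent_of_poly p) 1 = residue_coeff p g"
proof -
  have p: "p \<noteq> 0" using assms by auto
  define r where "r = g mod p"
  have "laurent_of_poly g = laurent_of_poly p * laurent_of_poly (g div p) + laurent_of_poly r"
    unfolding r_def laurent_of_poly_mult[symmetric] laurent_of_poly_add[symmetric] by simp
  then have eq: "laurent_of_poly g / laurent_of_poly p
      = laurent_of_poly (g div p) + laurent_of_poly r / laurent_of_poly p"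
    using p by (simp add: field_simps)
  have "fls_nth (laurent_of_poly r / laurent_of_poly p) 1 = coeff r (degree p - 1) / lead_coeff p"
  proof (cases "r = 0")
    case False
    have dr: "degree r < degree p"
      unfolding r_def by (rule degree_mod_less') (use p False r_def in auto)
    show ?thesis
    proof (cases "degree r = degree p - 1")
      case True
      then show ?thesis
        using fls_divide_nth_base[of "laurent_of_poly r" "laurent_of_poly p"] p False dr
        by (simp add: subdegree_laurent_of_poly fls_nth_laurent_of_poly nat_diff_distrib)
    next
      case neq: False
      then show ?thesis
        using fls_divide_nth_below[of 1 "laurent_of_poly r" "laurent_of_poly p"] p False dr
        by (simp add: subdegree_laurent_of_poly coeff_eq_0)
    qed
  qed auto
  then show ?thesis
    by (simp add: eq residue_coeff_def r_def fls_nth_laurent_of_poly)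
qed

text \<open>Multiplication by the \<open>i\<close>-th power of x moves the coefficient of index
  \<open>i + 1\<close> to index 1.\<close>

lemma fls_nth_Suc_divide_laurent_of_poly:
  fixes p :: "'a::field poly"
  assumes "degree p \<ge> 1"
  shows "fls_nth (laurent_of_poly g / laurent_of_poly p) (int (Suc i))
      = residue_coeff p (monom 1 i * g)"
proof -
  have "residue_coeff p (monom 1 i * g)
      = fls_nth (fls_X_inv ^ i * (laurent_of_poly g / laurent_of_poly p)) 1"
    by (simp add: fls_nth_1_divide_laurent_of_poly[OF assms, symmetric] laurent_of_poly_mult
        laurent_of_poly_monom)
  then show ?thesis
    by (simp add: fls_X_inv_power_times_conv_shift(1) add.commute
        del: times_divide_eq_right)
qed

text \<open>The lattice point as a function of the product of \<open>n\<close> and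
  \<open>q j\<close> alone. Digit positions are counted from 0 here: the digit at \<open>i\<close>
  is the Laurent coefficient of index \<open>i + 1\<close>.\<close>

definition digit_value :: "'p::prime_card mod_ring poly \<Rightarrow> 'p mod_ring poly \<Rightarrow> real" where
  "digit_value p g = (\<Sum>i<degree p.
     real_of_int (to_int_mod_ring (residue_coeff p (monom 1 i * g))) / real CARD('p) ^ Suc i)"

lemma lattice_point_eq_digit_value:
  fixes p :: "'p::prime_card mod_ring poly"
  assumes "degree p \<ge> 1"
  shows "lattice_point q p n j = digit_value p (poly_of_nat n * q j)"
proof -
  have "{1..degree p} = Suc ` {..<degree p}"
    by (simp add: lessThan_atLeast0 image_Suc_atLeastLessThan atLeastLessThanSuc_atLeastAtMost)
  then show ?thesis
    by (simp add: lattice_point_def laurent_trunc_def digit_value_def sum.reindex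
        fls_nth_Suc_divide_laurent_of_poly[OF assms] del: of_nat_Suc flip: laurent_of_poly_mult)
qed

lemma poly_of_nat_step:
  "(poly_of_nat n :: 'p::prime_card mod_ring poly)
     = pCons (of_nat (n mod CARD('p))) (poly_of_nat (n div CARD('p)))"
proof (rule poly_eqI)
  fix i
  have b: "Suc 0 < CARD('p)" using prime_gt_1_nat[OF prime_card[where 'a='p]] by simp
  \<comment> \<open>The defining sum stops at index \<open>k\<close>; beyond it the digit is 0 as
    well, because \<open>k < i < b ^ i\<close>.\<close>
  have c: "coeff (poly_of_nat k :: 'p mod_ring poly) i = of_nat (k div CARD('p) ^ i mod CARD('p))" for k i
  proof -
    have "k div CARD('p) ^ i = 0" if "k < i"
      using that power_gt_expt[OF b, of i] by (intro div_less) (meson less_trans)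
    then show ?thesis
      by (auto simp: poly_of_nat_def coeff_sum coeff_monom not_le if_distrib cong: if_cong)
  qed
  show "coeff (poly_of_nat n :: 'p mod_ring poly) i
      = coeff (pCons (of_nat (n mod CARD('p))) (poly_of_nat (n div CARD('p)))) i"
    by (cases i) (simp_all add: c div_mult2_eq)
qed

text \<open>Induction on the number of digits: the lowest digit and the quotient by \<open>b\<close>
  correspond to the head and the tail of \<open>pCons\<close>.\<close>

lemma bij_betw_poly_of_nat:
  "bij_betw poly_of_nat {..<CARD('p) ^ a} (poly_below a :: 'p::prime_card mod_ring poly set)"
proof (induction a)
  case 0
  show ?case by (auto simp: bij_betw_def poly_below_def poly_range_def poly_of_nat_def inj_on_def)
next
  case (Suc a)
  let ?b = "CARD('p)"
  let ?H = "\<lambda>a. poly_below a :: 'p mod_ring poly set"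
  have b: "0 < ?b" by simp
  have H: "pCons c h \<in> ?H (Suc a) \<longleftrightarrow> h \<in> ?H a" for c h
    by (auto simp: poly_below_def poly_range_def degree_pCons_eq_if)
  show ?case
  proof (rule bij_betw_imageI)
    show "inj_on (poly_of_nat :: nat \<Rightarrow> 'p mod_ring poly) {..<?b ^ Suc a}"
    proof (rule inj_onI)
      fix x y assume xy: "x \<in> {..<?b ^ Suc a}" "y \<in> {..<?b ^ Suc a}"
        and eq: "(poly_of_nat x :: 'p mod_ring poly) = poly_of_nat y"
      have "of_nat (x mod ?b) = (of_nat (y mod ?b) :: 'p mod_ring)"
        and d: "(poly_of_nat (x div ?b) :: 'p mod_ring poly) = poly_of_nat (y div ?b)"
        using eq by (subst (asm) (1 2) poly_of_nat_step, simp)+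
      \<comment> \<open>Equality in characteristic \<open>b\<close> is congruence modulo
        \<open>b\<close>, and both digits are already reduced.\<close>
      then have "x mod ?b = y mod ?b"
        by (metis b mod_mod_trivial of_nat_eq_iff_cong_CHAR cong_def semiring_char_mod_ring)
      moreover have "x div ?b = y div ?b"
        using Suc.IH d xy by (auto simp: bij_betw_def less_mult_imp_div_less mult.commute dest!: inj_onD)
      ultimately show "x = y" by (metis div_mult_mod_eq)
    qed
    show "(poly_of_nat :: nat \<Rightarrow> 'p mod_ring poly) ` {..<?b ^ Suc a} = ?H (Suc a)"
    proof (intro equalityI subsetI)
      fix g :: "'p mod_ring poly" assume "g \<in> poly_of_nat ` {..<?b ^ Suc a}"
      then obtain n where n: "n < ?b ^ Suc a" "g = poly_of_nat n" by auto
      have "poly_of_nat (n div ?b) \<in> ?H a"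
        using n bij_betwE[OF Suc.IH] by (auto simp: less_mult_imp_div_less mult.commute)
      then show "g \<in> ?H (Suc a)"
        using H n(2) by (subst (asm) (2) poly_of_nat_step) metis
    next
      fix g :: "'p mod_ring poly" assume g: "g \<in> ?H (Suc a)"
      obtain c h where gh: "g = pCons c h" by (cases g)
      then have "h \<in> ?H a" using g H by metis
      then obtain n where n: "n < ?b ^ a" "h = poly_of_nat n"
        using bij_betw_imp_surj_on[OF Suc.IH] by (metis imageE lessThan_iff)
      obtain i where i: "i < ?b" "c = of_nat i" using surj_of_nat_mod_ring by blast
      have "poly_of_nat (n * ?b + i) = g"
        using i by (subst poly_of_nat_step) (simp add: gh n(2))
      moreover have "n * ?b + i < ?b ^ Suc a"
      proof -
        have "n * ?b + i < (n + 1) * ?b" using i by simp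
        also have "\<dots> \<le> ?b ^ a * ?b" using n by (intro mult_right_mono) auto
        finally show ?thesis by (simp add: mult.commute)
      qed
      ultimately show "g \<in> poly_of_nat ` {..<?b ^ Suc a}" by blast
    qed
  qed
qed

lemma finite_poly_below [simp]: "finite (poly_below a :: 'p::prime_card mod_ring poly set)"
  using bij_betw_finite[OF bij_betw_poly_of_nat[where 'p='p, of a]] by simp

lemma finite_poly_range [simp]: "finite (poly_range a :: 'p::prime_card mod_ring poly set)"
  using finite_poly_below[of a] by (simp add: poly_below_def)

lemma card_poly_below: "card (poly_below a :: 'p::prime_card mod_ring poly set) = CARD('p) ^ a"
  using bij_betw_same_card[OF bij_betw_poly_of_nat[where 'p='p, of a]] by simp

subsection \<open>Character expansions\<close>

text \<open>By homogeneity the two arguments may be scaled to sum 1, and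
  \<open>t \<le> t powr l\<close> on the unit interval.\<close>

lemma powr_add_le_powr_add_powr:
  fixes x y l :: real
  assumes "x \<ge> 0" "y \<ge> 0" "0 < l" "l \<le> 1"
  shows "(x + y) powr l \<le> x powr l + y powr l"
proof (cases "x + y = 0")
  case False
  then have s: "x + y > 0" using assms by simp
  have *: "t \<le> t powr l" if "0 \<le> t" "t \<le> 1" for t :: real
    using powr_mono'[of l 1 t] that assms by (cases "t = 0") auto
  have "1 = x / (x + y) + y / (x + y)" using s by (simp flip: add_divide_distrib)
  also have "\<dots> \<le> (x / (x + y)) powr l + (y / (x + y)) powr l"
    using assms s by (intro add_mono *) auto
  also have "\<dots> = (x powr l + y powr l) / (x + y) powr l"
    using assms by (simp add: powr_divide add_divide_distrib)
  finally show ?thesis using s by (simp add: field_simps)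
qed (use assms in auto)

lemma powr_sum_le_sum_powr:
  fixes f :: "'i \<Rightarrow> real"
  assumes "\<And>i. i \<in> A \<Longrightarrow> f i \<ge> 0" "0 < l" "l \<le> 1"
  shows "(\<Sum>i\<in>A. f i) powr l \<le> (\<Sum>i\<in>A. f i powr l)"
  using assms(1)
proof (induction A rule: infinite_finite_induct)
  case (insert x A)
  have "(f x + sum f A) powr l \<le> f x powr l + sum f A powr l"
    using insert assms by (intro powr_add_le_powr_add_powr sum_nonneg) auto
  with insert show ?case by fastforce
qed auto

section \<open>Additive characters and their orthogonality\<close>

definition mod_char :: "'p::prime_card mod_ring \<Rightarrow> complex" where
  "mod_char a = cis (2 * pi * (real_of_int (to_int_mod_ring a) / real CARD('p)))"

lemma mod_char_0 [simp]: "mod_char 0 = 1"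
  by (simp add: mod_char_def)

text \<open>Reducing the sum of representatives modulo \<open>b\<close> changes the angle by a
  multiple of \<open>2 * pi\<close>.\<close>

lemma mod_char_add: "mod_char (a + b) = mod_char a * mod_char (b :: 'p::prime_card mod_ring)"
proof -
  define k where "k = to_int_mod_ring a + to_int_mod_ring b"
  let ?b = "int CARD('p)"
  have "real_of_int (k mod ?b) / real CARD('p) = real_of_int k / real CARD('p) - real_of_int (k div ?b)"
    by (simp add: minus_div_mult_eq_mod[symmetric] field_simps)
  then have "mod_char (a + b)
      = cis (2 * pi * (real_of_int k / real CARD('p)) - 2 * pi * real_of_int (k div ?b))"
    unfolding mod_char_def to_int_mod_ring_add k_def[symmetric] by (simp add: right_diff_distrib)
  also have "\<dots> = cis (2 * pi * (real_of_int k / real CARD('p)))"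
    by (simp add: cis_divide[symmetric] cis_multiple_2pi)
  also have "\<dots> = mod_char a * mod_char b"
    by (simp add: mod_char_def cis_mult k_def add_divide_distrib distrib_left)
  finally show ?thesis .
qed

lemma mod_char_eq_1_iff: "mod_char a = 1 \<longleftrightarrow> a = (0 :: 'p::prime_card mod_ring)"
proof
  assume "mod_char a = 1"
  then have "cos (2 * pi * (real_of_int (to_int_mod_ring a) / real CARD('p))) = 1"
    by (auto simp: mod_char_def complex_eq_iff)
  then obtain n :: int where
    "2 * pi * (real_of_int (to_int_mod_ring a) / real CARD('p)) = of_int n * 2 * pi"
    by (auto simp: cos_one_2pi_int)
  then have "real_of_int (to_int_mod_ring a) = real_of_int (n * int CARD('p))"
    by (simp add: field_simps)
  then have eq: "to_int_mod_ring a = n * int CARD('p)" by linarith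
  have "to_int_mod_ring a \<in> {0..<int CARD('p)}"
    using range_to_int_mod_ring[where 'a='p] by blast
  then have "to_int_mod_ring a = 0" using eq by (metis atLeastLessThan_iff mod_mult_self2_is_0 mod_pos_pos_trivial)
  then show "a = 0" by simp
qed auto

text \<open>The maps sending \<open>g\<close> to \<open>residue_char p (k * g)\<close> are additive
  characters modulo \<open>p\<close>, distinct for distinct residues \<open>k\<close> by
  nondegeneracy. They play the part of the Walsh functions.\<close>

definition residue_char :: "'p::prime_card mod_ring poly \<Rightarrow> 'p mod_ring poly \<Rightarrow> complex" where
  "residue_char p g = mod_char (residue_coeff p g)"

lemma residue_char_0 [simp]: "residue_char p 0 = 1"
  by (simp add: residue_char_def)

lemma residue_char_add: "residue_char p (g + h) = residue_char p g * residue_char p h"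
  by (simp add: residue_char_def residue_coeff_add mod_char_add)

lemma add_in_poly_below:
  "k \<in> poly_below a \<Longrightarrow> l \<in> poly_below a \<Longrightarrow> k + l \<in> poly_below a"
  by (auto simp: poly_below_def poly_range_def intro: degree_add_less)

lemma diff_in_poly_below:
  fixes k :: "'a::field poly"
  shows "k \<in> poly_below a \<Longrightarrow> l \<in> poly_below a \<Longrightarrow> k - l \<in> poly_below a"
  by (auto simp: poly_below_def poly_range_def intro: degree_diff_less)

lemma sum_poly_below_shift:
  fixes h :: "'p::prime_card mod_ring poly \<Rightarrow> 'c::comm_monoid_add"
  assumes "l \<in> poly_below a"
  shows "(\<Sum>k\<in>poly_below a. h (k + l)) = (\<Sum>k\<in>poly_below a. h k)"
  by (rule sum.reindex_bij_witness[of _ "\<lambda>k. k - l" "\<lambda>k. k + l"])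
     (use assms add_in_poly_below diff_in_poly_below in auto)

text \<open>If some power of x pairs nontrivially with \<open>g\<close>, translating the summation
  by it multiplies the sum by a number other than 1. The range \<open>a\<close> is kept independent
  of \<open>degree p\<close>, since the expansion of \<open>phi\<close> is summed degree by
  degree.\<close>

lemma sum_residue_char:
  "(\<Sum>k\<in>poly_below a. residue_char p (k * g))
     = (if \<forall>i<a. residue_coeff p (monom 1 i * g) = 0 then of_nat (CARD('p) ^ a) else 0)"
  for p :: "'p::prime_card mod_ring poly"
proof (cases "\<forall>i<a. residue_coeff p (monom 1 i * g) = 0")
  case True
  then have "residue_char p (k * g) = 1" if "k \<in> poly_below a" for k
    using residue_coeff_mult[OF that, of p g] by (simp add: residue_char_def)
  then have "(\<Sum>k\<in>poly_below a. residue_char p (k * g))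
      = of_nat (card (poly_below a :: 'p mod_ring poly set))"
    by simp
  with True show ?thesis unfolding card_poly_below by simp
next
  case False
  then obtain i where i: "i < a" "residue_coeff p (monom 1 i * g) \<noteq> 0" by auto
  define l where "l = (monom 1 i :: 'p mod_ring poly)"
  have l: "l \<in> poly_below a" using i by (simp add: l_def poly_below_def poly_range_def degree_monom_eq)
  define S where "S = (\<Sum>k\<in>poly_below a. residue_char p (k * g))"
  have "S = (\<Sum>k\<in>poly_below a. residue_char p ((k + l) * g))"
    unfolding S_def by (rule sum_poly_below_shift[OF l, symmetric])
  also have "\<dots> = S * residue_char p (l * g)"
    unfolding S_def sum_distrib_right by (simp add: distrib_right residue_char_add)
  finally have "S * (1 - residue_char p (l * g)) = 0" by (simp add: algebra_simps)
  moreover have "residue_char p (l * g) \<noteq> 1"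
    using i by (simp add: residue_char_def mod_char_eq_1_iff l_def)
  ultimately have "S = 0" by simp
  then show ?thesis unfolding S_def using False by auto
qed

definition lattice_mean :: "'p::prime_card mod_ring poly \<Rightarrow> ('p mod_ring poly \<Rightarrow> real) \<Rightarrow> real" where
  "lattice_mean p F = 1 / real CARD('p) ^ degree p * (\<Sum>n<CARD('p) ^ degree p. F (poly_of_nat n))"

section \<open>Character expansions over the residue field\<close>

locale irreducible_modulus =
  fixes p :: "'p::prime_card mod_ring poly"
  assumes irreducible_p: "irreducible p"
begin

abbreviation H :: "'p mod_ring poly set" where
  "H \<equiv> poly_below (degree p)"

lemma p_nz: "p \<noteq> 0" and degree_pos: "degree p > 0"
  using irreducible_p by (auto simp: irreducible_def is_unit_iff_degree)

lemma finite_H: "finite H" by simp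

lemma H_eq: "H = insert 0 (poly_range (degree p))"
  by (simp add: poly_below_def)

lemma zero_notin_poly_range: "(0 :: 'p mod_ring poly) \<notin> poly_range a"
  by (simp add: poly_range_def)

lemma card_H: "card H = CARD('p) ^ degree p" by (rule card_poly_below)

lemma mod_in_H: "g mod p \<in> H"
  using degree_mod_less[OF p_nz, of g] by (auto simp: poly_below_def poly_range_def)

lemma mod_H: "g \<in> H \<Longrightarrow> g mod p = g"
  by (auto simp: poly_below_def poly_range_def mod_poly_less)

lemma not_dvd_poly_range: "q \<in> poly_range (degree p) \<Longrightarrow> \<not> p dvd q"
  by (auto simp: poly_range_def dest: dvd_imp_degree_le)

lemma prime_p: "prime_elem p"
  using irreducible_p by (simp add: irreducible_imp_prime_elem_gcd)

text \<open>Injectivity holds because \<open>p\<close> is a prime element, and an injective self-map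
  of a finite set is onto.\<close>

lemma bij_betw_mult_mod:
  assumes "\<not> p dvd q"
  shows "bij_betw (\<lambda>k. (k * q) mod p) H H"
proof -
  have inj: "inj_on (\<lambda>k. (k * q) mod p) H"
  proof (rule inj_onI)
    fix k l assume kl: "k \<in> H" "l \<in> H" "(k * q) mod p = (l * q) mod p"
    then have "p dvd (k - l) * q" by (metis mod_eq_dvd_iff left_diff_distrib)
    then have "p dvd k - l" using assms prime_p by (simp add: prime_elem_dvd_mult_iff)
    then have "k mod p = l mod p" by (simp add: mod_eq_dvd_iff)
    then show "k = l" using kl by (simp add: mod_H)
  qed
  then show ?thesis
    using endo_inj_surj[OF finite_H image_subsetI inj] mod_in_H by (intro bij_betw_imageI) blast+
qed

text \<open>The integers below \<open>b ^ degree p\<close> enumerate \<open>H\<close>, and by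
  nondegeneracy the orthogonality condition becomes divisibility by \<open>p\<close>.\<close>

lemma mean_residue_char:
  "(\<Sum>n<CARD('p) ^ degree p. residue_char p (k * poly_of_nat n))
     = (if p dvd k then of_nat (CARD('p) ^ degree p) else 0)"
proof -
  have "(\<Sum>n<CARD('p) ^ degree p. residue_char p (k * poly_of_nat n))
      = (\<Sum>g\<in>H. residue_char p (g * k))"
    using sum.reindex_bij_betw[OF bij_betw_poly_of_nat, of "\<lambda>g. residue_char p (g * k)" "degree p"]
    by (simp only: mult.commute)
  also have "\<dots> = (if p dvd k then of_nat (CARD('p) ^ degree p) else 0)"
    unfolding sum_residue_char using residue_coeff_nondegenerate[of p k] p_nz
    by (auto simp: residue_coeff_def mod_0_imp_dvd)
  finally show ?thesis .
qed

text \<open>Non-negativity is asked of every \<open>k\<close>, so that convolutions and dilations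
  can evaluate \<open>a\<close> without membership conditions; the expansion itself runs over
  reduced residues.\<close>

definition has_coeffs :: "('p mod_ring poly \<Rightarrow> real) \<Rightarrow> ('p mod_ring poly \<Rightarrow> real) \<Rightarrow> bool" where
  "has_coeffs F a \<longleftrightarrow> (\<forall>k. a k \<ge> 0) \<and>
     (\<forall>g. complex_of_real (F g) = (\<Sum>k\<in>H. of_real (a k) * residue_char p (k * g)))"

text \<open>Averaging kills every character except the trivial one.\<close>

lemma lattice_mean_eq:
  assumes "has_coeffs F a"
  shows "lattice_mean p F = a 0"
proof -
  let ?N = "CARD('p) ^ degree p"
  have "complex_of_real (\<Sum>n<?N. F (poly_of_nat n))
      = (\<Sum>n<?N. \<Sum>k\<in>H. of_real (a k) * residue_char p (k * poly_of_nat n))"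
    using assms by (simp add: has_coeffs_def)
  also have "\<dots> = (\<Sum>k\<in>H. of_real (a k) * (\<Sum>n<?N. residue_char p (k * poly_of_nat n)))"
    by (subst sum.swap) (simp only: sum_distrib_left)
  also have "\<dots> = (\<Sum>k\<in>H. if k = 0 then of_real (a 0) * of_nat ?N else 0)"
    unfolding mean_residue_char by (intro sum.cong) (use not_dvd_poly_range in \<open>auto simp: poly_below_def\<close>)
  also have "\<dots> = complex_of_real (a 0 * real ?N)"
    by (subst sum.delta) (auto simp: poly_below_def)
  finally have "(\<Sum>n<?N. F (poly_of_nat n)) = a 0 * real ?N"
    by (simp only: of_real_eq_iff)
  then show ?thesis by (simp add: lattice_mean_def)
qed

lemma has_coeffs_const:
  assumes "c \<ge> 0"
  shows "has_coeffs (\<lambda>g. c) (\<lambda>k. if k = 0 then c else 0)"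
proof -
  have "(\<Sum>k\<in>H. of_real (if k = 0 then c else 0) * residue_char p (k * g))
      = (\<Sum>k\<in>H. if k = 0 then complex_of_real c else 0)" for g
    by (intro sum.cong) auto
  then show ?thesis
    using assms by (simp add: has_coeffs_def poly_below_def)
qed

lemma has_coeffs_add:
  assumes "has_coeffs F a" "has_coeffs G c"
  shows "has_coeffs (\<lambda>g. F g + G g) (\<lambda>k. a k + c k)"
  using assms by (simp add: has_coeffs_def sum.distrib distrib_right)

text \<open>Characters multiply by adding indices, so the coefficients are convolved over the
  additive group \<open>H\<close>.\<close>

lemma has_coeffs_mult:
  assumes "has_coeffs F a" "has_coeffs G c"
  shows "has_coeffs (\<lambda>g. F g * G g) (\<lambda>k. \<Sum>l\<in>H. a l * c (k - l))"
proof -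
  have "complex_of_real (F g * G g)
      = (\<Sum>k\<in>H. of_real (\<Sum>l\<in>H. a l * c (k - l)) * residue_char p (k * g))" for g
  proof -
    have "complex_of_real (F g * G g) = (\<Sum>l\<in>H. \<Sum>k\<in>H.
        of_real (a l) * residue_char p (l * g) * (of_real (c k) * residue_char p (k * g)))"
      using assms by (simp only: has_coeffs_def of_real_mult sum_product)
    \<comment> \<open>Writing \<open>k\<close> as \<open>k + l - l\<close> makes the summand a
      function of \<open>k + l\<close>, ready for the shift of the inner sum.\<close>
    also have "\<dots> = (\<Sum>l\<in>H. \<Sum>k\<in>H.
        of_real (a l * c (k + l - l)) * residue_char p ((k + l) * g))"
      unfolding distrib_right residue_char_add by (simp add: mult_ac)
    also have "\<dots> = (\<Sum>l\<in>H. \<Sum>k\<in>H. of_real (a l * c (k - l)) * residue_char p (k * g))"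
      by (intro sum.cong refl
          sum_poly_below_shift[where h = "\<lambda>k. of_real (a _ * c (k - _)) * residue_char p (k * g)"])
    also have "\<dots> = (\<Sum>k\<in>H. of_real (\<Sum>l\<in>H. a l * c (k - l)) * residue_char p (k * g))"
      by (subst sum.swap) (simp only: sum_distrib_right of_real_sum)
    finally show ?thesis .
  qed
  then show ?thesis
    using assms unfolding has_coeffs_def by (auto intro!: sum_nonneg)
qed

text \<open>Dilation by \<open>q\<close> permutes the characters; the inverse of multiplication by
  \<open>q\<close> on \<open>H\<close> says which old coefficient lands on \<open>k\<close>.\<close>

lemma has_coeffs_dilate:
  assumes "has_coeffs F a" "\<not> p dvd q"
  shows "has_coeffs (\<lambda>g. F (q * g)) (\<lambda>k. a (inv_into H (\<lambda>k. (k * q) mod p) k))"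
proof -
  have e: "residue_char p ((k * q) mod p * g) = residue_char p (k * (q * g))" for k g
  proof -
    have "residue_coeff p ((k * q) mod p * g) = residue_coeff p (g * (k * q))"
      by (subst mult.commute) (rule residue_coeff_mult_mod)
    then show ?thesis by (simp add: residue_char_def mult_ac)
  qed
  have "complex_of_real (F (q * g)) = (\<Sum>k\<in>H. of_real
      (a (inv_into H (\<lambda>k. (k * q) mod p) k)) * residue_char p (k * g))" for g
  proof -
    have "(\<Sum>k\<in>H. of_real (a (inv_into H (\<lambda>k. (k * q) mod p) k)) * residue_char p (k * g))
        = (\<Sum>k\<in>H. of_real (a k) * residue_char p (k * (q * g)))"
      by (rule trans[OF sum.reindex_bij_betw[OF bij_betw_mult_mod[OF assms(2)], symmetric]],
          intro sum.cong refl)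
         (simp only: e inv_into_f_f[OF bij_betw_imp_inj_on[OF bij_betw_mult_mod[OF assms(2)]]])
    then show ?thesis using assms(1) by (simp add: has_coeffs_def)
  qed
  then show ?thesis using assms(1) by (simp add: has_coeffs_def)
qed

text \<open>
  The averaging step: \<open>k * q'\<close> runs through all nonzero residues as \<open>q'\<close> does, for each fixed
  nonzero \<open>k\<close>, so that the terms with \<open>k \<noteq> 0\<close> decouple, and the term \<open>k = 0\<close> is
  absorbed because \<open>c 0\<close> is the smallest coefficient.
\<close>

lemma minimal_mean_bound:
  assumes P: "has_coeffs P a" and f: "has_coeffs f c"
    and c0: "\<And>k. c 0 \<le> c k"
    and lam: "0 < lam" "lam \<le> 1"
    and min: "\<And>q'. q' \<in> poly_range (degree p) \<Longrightarrow> t \<le> lattice_mean p (\<lambda>g. P g * f (q' * g))"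
    and t: "t \<ge> 0"
  shows "(real CARD('p) ^ degree p - 1) * t powr lam
    \<le> (\<Sum>k\<in>H. c k powr lam) * (\<Sum>k\<in>H. a k powr lam)"
proof -
  let ?R = "poly_range (degree p) :: 'p mod_ring poly set"
  let ?A = "\<lambda>k. a k powr lam" and ?C = "\<lambda>k. c k powr lam"
  note H_eq [simp] zero_notin_poly_range [simp]
  have a: "a k \<ge> 0" and c: "c k \<ge> 0" for k using P f by (auto simp: has_coeffs_def)
  define M where "M = real (card ?R)"
  have M: "M = real CARD('p) ^ degree p - 1"
    using card_H by (simp add: M_def)
      (metis of_nat_power of_nat_Suc add_diff_cancel_left')
  \<comment> \<open>The mean is the convolution of both coefficient families at index 0. It pairs
    \<open>k * q'\<close> with its negative.\<close>
  have mean: "lattice_mean p (\<lambda>g. P g * f (q' * g)) = (\<Sum>k\<in>H. c k * a ((- k * q') mod p))"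
    if "q' \<in> ?R" for q'
  proof -
    note ndvd = not_dvd_poly_range[OF that]
    note bij = bij_betw_mult_mod[OF ndvd]
    have "lattice_mean p (\<lambda>g. f (q' * g) * P g)
       = (\<Sum>l\<in>H. c (inv_into H (\<lambda>k. (k * q') mod p) l) * a (0 - l))"
      by (rule lattice_mean_eq[OF has_coeffs_mult[OF has_coeffs_dilate[OF f ndvd] P]])
    also have "\<dots> = (\<Sum>k\<in>H. c k * a (- ((k * q') mod p)))"
      by (rule trans[OF sum.reindex_bij_betw[OF bij, symmetric]], intro sum.cong refl)
         (simp only: inv_into_f_f[OF bij_betw_imp_inj_on[OF bij]] diff_0)
    also have "\<dots> = (\<Sum>k\<in>H. c k * a ((- k * q') mod p))"
      by (simp add: poly_mod_minus_left)
    finally show ?thesis by (simp add: mult.commute)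
  qed
  have "M * t powr lam = (\<Sum>q'\<in>?R. t powr lam)" by (simp add: M_def)
  also have "\<dots> \<le> (\<Sum>q'\<in>?R. \<Sum>k\<in>H. ?C k * ?A ((- k * q') mod p))"
  proof (rule sum_mono)
    fix q' assume q': "q' \<in> ?R"
    have "t powr lam \<le> (\<Sum>k\<in>H. c k * a ((- k * q') mod p)) powr lam"
      using min[OF q'] t lam by (intro powr_mono2) (auto simp: mean[OF q'])
    also have "\<dots> \<le> (\<Sum>k\<in>H. (c k * a ((- k * q') mod p)) powr lam)"
      using lam a c by (intro powr_sum_le_sum_powr) auto
    finally show "t powr lam \<le> (\<Sum>k\<in>H. ?C k * ?A ((- k * q') mod p))"
      using a c by (simp add: powr_mult)
  qed
  also have "\<dots> = (\<Sum>k\<in>H. \<Sum>q'\<in>?R. ?C k * ?A ((- k * q') mod p))" by (rule sum.swap)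
  also have "\<dots> = ?C 0 * (M * ?A 0) + (\<Sum>k\<in>?R. ?C k * (\<Sum>q'\<in>?R. ?A ((- k * q') mod p)))"
    by (simp add: M_def sum_distrib_left)
  also have "(\<Sum>k\<in>?R. ?C k * (\<Sum>q'\<in>?R. ?A ((- k * q') mod p))) = (\<Sum>k\<in>?R. ?C k * (\<Sum>g\<in>?R. ?A g))"
  proof (rule sum.cong[OF refl])
    fix k assume "k \<in> ?R"
    then have "\<not> p dvd - k" using not_dvd_poly_range by simp
    then have "(\<Sum>q'\<in>H. ?A ((q' * - k) mod p)) = (\<Sum>g\<in>H. ?A g)"
      by (rule sum.reindex_bij_betw[OF bij_betw_mult_mod])
    then have "(\<Sum>q'\<in>?R. ?A ((- k * q') mod p)) = (\<Sum>g\<in>?R. ?A g)"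
      by (simp add: mult.commute)
    then show "?C k * (\<Sum>q'\<in>?R. ?A ((- k * q') mod p)) = ?C k * (\<Sum>g\<in>?R. ?A g)" by simp
  qed
  also have "?C 0 * (M * ?A 0) + (\<Sum>k\<in>?R. ?C k * (\<Sum>g\<in>?R. ?A g))
      = (M * ?C 0) * ?A 0 + (\<Sum>k\<in>?R. ?C k) * (\<Sum>g\<in>?R. ?A g)"
    by (subst sum_distrib_right[symmetric]) (simp add: mult_ac)
  also have "\<dots> \<le> (\<Sum>k\<in>?R. ?C k) * ?A 0 + (\<Sum>k\<in>?R. ?C k) * (\<Sum>g\<in>?R. ?A g)"
  proof (intro add_right_mono mult_right_mono)
    have "M * ?C 0 = (\<Sum>k\<in>?R. ?C 0)" by (simp add: M_def)
    also have "\<dots> \<le> (\<Sum>k\<in>?R. ?C k)"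
      using c0 c lam by (intro sum_mono powr_mono2) auto
    finally show "M * ?C 0 \<le> (\<Sum>k\<in>?R. ?C k)" .
  qed auto
  also have "\<dots> = (\<Sum>k\<in>?R. ?C k) * (\<Sum>k\<in>H. ?A k)"
    by (simp add: distrib_left)
  also have "\<dots> \<le> (\<Sum>k\<in>H. ?C k) * (\<Sum>k\<in>H. ?A k)"
    by (intro mult_right_mono sum_nonneg) auto
  finally show ?thesis by (simp add: M)
qed

end

subsection \<open>Walsh coefficients\<close>

text \<open>The polynomials of degree exactly \<open>a\<close> form a difference of two initial
  segments. It is applied with \<open>F\<close> a character, to expand \<open>phi\<close>, and with
  \<open>F\<close> constant 1, to compute power sums.\<close>

lemma sum_poly_below_by_degree:
  fixes F :: "'p::prime_card mod_ring poly \<Rightarrow> 'c::comm_ring_1"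
  shows "(\<Sum>k\<in>poly_below m. (if k = 0 then 0 else h (degree k)) * F k)
    = (\<Sum>a<m. h a * ((\<Sum>k\<in>poly_below (Suc a). F k) - (\<Sum>k\<in>poly_below a. F k)))"
proof (induction m)
  case 0
  show ?case by (simp add: poly_below_def poly_range_def)
next
  case (Suc m)
  define D where "D = poly_below (Suc m) - (poly_below m :: 'p mod_ring poly set)"
  have sub: "poly_below m \<subseteq> (poly_below (Suc m) :: 'p mod_ring poly set)"
    by (auto simp: poly_below_def poly_range_def)
  have split: "sum f (poly_below (Suc m)) = sum f D + sum f (poly_below m)"
    for f :: "'p mod_ring poly \<Rightarrow> 'c"
    unfolding D_def by (rule sum.subset_diff[OF sub]) simp
  have "(\<Sum>k\<in>D. (if k = 0 then 0 else h (degree k)) * F k) = (\<Sum>k\<in>D. h m * F k)"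
    by (rule sum.cong) (auto simp: D_def poly_below_def poly_range_def less_Suc_eq)
  then have "(\<Sum>k\<in>poly_below (Suc m). (if k = 0 then 0 else h (degree k)) * F k)
      = h m * sum F D + (\<Sum>k\<in>poly_below m. (if k = 0 then 0 else h (degree k)) * F k)"
    by (simp only: split sum_distrib_left)
  also have "sum F D = sum F (poly_below (Suc m)) - sum F (poly_below m)"
    by (simp add: split)
  finally show ?case using Suc.IH by (simp add: add.commute)
qed

text \<open>With \<open>x = b\<close>, the factor \<open>x ^ Suc a - x ^ a\<close> counts the
  polynomials of degree \<open>a\<close>. Each summand is a difference of consecutive values of the
  right-hand side.\<close>

lemma geometric_digit_sum:
  fixes x y :: real
  assumes "y > x" "x > 0"
  shows "(\<Sum>a<n. (1 / y) ^ Suc a * (x ^ Suc a - x ^ a)) = (x - 1) / (y - x) * (1 - (x / y) ^ n)"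
proof (induction n)
  case (Suc n)
  have ny: "y \<noteq> 0" "y - x \<noteq> 0" using assms by auto
  have eq: "(1 / y) ^ Suc n * (x ^ Suc n - x ^ n) = (x - 1) / (y - x) * ((x / y) ^ n - (x / y) ^ Suc n)"
  proof -
    have "(1 / y) ^ Suc n * (x ^ Suc n - x ^ n) = (x / y) ^ n * ((x - 1) / y)"
      by (simp add: power_divide right_diff_distrib left_diff_distrib diff_divide_distrib mult.commute)
    also have "(x - 1) / y = (x - 1) / (y - x) * (1 - x / y)"
      using ny by (simp add: field_simps)
    also have "(x / y) ^ n * ((x - 1) / (y - x) * (1 - x / y))
        = (x - 1) / (y - x) * ((x / y) ^ n * (1 - x / y))"
      by (rule mult.left_commute)
    also have "(x / y) ^ n * (1 - x / y) = (x / y) ^ n - (x / y) ^ Suc n"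
      by (simp only: right_diff_distrib power_Suc2 mult_1_right)
    finally show ?thesis .
  qed
  show ?case
    unfolding sum.lessThan_Suc Suc.IH eq by (simp add: right_diff_distrib)
qed simp

text \<open>Here \<open>S a\<close> models the character sum over \<open>poly_below a\<close> when
  the first nonzero digit has position \<open>i\<close>. Terms with \<open>a < i\<close> are those
  of the geometric sum, the term \<open>a = i\<close> is negative, and all later ones
  vanish.\<close>

lemma truncated_digit_sum:
  fixes x y :: real and i :: nat
  assumes "y > x" "x > 0"
  defines "S \<equiv> \<lambda>a. if a \<le> i then x ^ a else 0"
  shows "(\<Sum>a<n. (1 / y) ^ Suc a * (S (Suc a) - S a))
    = (if n \<le> i then (x - 1) / (y - x) * (1 - (x / y) ^ n)
       else (x - 1 - (x / y) ^ Suc i * (y - 1)) / (y - x))"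
proof (induction n)
  case (Suc n)
  have ny: "y \<noteq> 0" "y - x \<noteq> 0" using assms by auto
  consider "n < i" | "n = i" | "n > i" by linarith
  then show ?case
  proof cases
    case 1
    have "(\<Sum>a<Suc n. (1 / y) ^ Suc a * (S (Suc a) - S a))
        = (\<Sum>a<Suc n. (1 / y) ^ Suc a * (x ^ Suc a - x ^ a))"
      using 1 by (intro sum.cong) (auto simp: S_def)
    then show ?thesis
      using 1 geometric_digit_sum[OF assms(1,2), of "Suc n"] by (simp only: Suc_le_eq if_True)
  next
    case 2
    have "(x - 1) / (y - x) * (1 - (x / y) ^ i) - (1 / y) ^ Suc i * x ^ i
        = (x - 1 - (x / y) ^ Suc i * (y - 1)) / (y - x)"
    proof -
      have *: "(x / y) ^ Suc i * (y - 1) = (x / y) ^ i * (x * (y - 1) / y)"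
        "(1 / y) ^ Suc i * x ^ i = (x / y) ^ i / y"
        by (simp_all add: power_divide mult_ac)
      have eq: "x - 1 - r * (x * (y - 1) / y) = (x - 1) * (1 - r) - (y - x) * (r / y)" for r
        using ny(1) by (simp add: field_simps)
      have "(x - 1) / (y - x) * (1 - r) - r / y = (x - 1 - r * (x * (y - 1) / y)) / (y - x)" for r
        unfolding eq
        by (simp only: diff_divide_distrib[of "(x - 1) * (1 - r)"]
            nonzero_mult_div_cancel_left[OF ny(2)] times_divide_eq_left)
      then show ?thesis unfolding * .
    qed
    then show ?thesis using 2 Suc by (simp add: S_def)
  next
    case 3
    then show ?thesis using Suc by (simp add: S_def)
  qed
qed simp

section \<open>The function \<open>phi\<close> in terms of the first nonzero digit\<close>

lemma phi_eq:
  assumes "b > 1" "min \<alpha> d > 1"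
  shows "phi b \<alpha> d z = (real b - 1 - pow_floor_log b z ^ (min \<alpha> d - 1) * (real b ^ min \<alpha> d - 1)) /
    (real b ^ min \<alpha> d - real b) / real b powr (real \<alpha> / 2)"
proof -
  have "real b * real b ^ (min \<alpha> d - 1) = real b ^ min \<alpha> d"
    using assms by (metis gr_implies_not0 power_eq_if)
  moreover have "real b powr ((real \<alpha> + 2) / 2) = real b powr (real \<alpha> / 2) * real b"
    using assms by (simp add: add_divide_distrib powr_add)
  ultimately have "real b powr ((real \<alpha> + 2) / 2) * (real b ^ (min \<alpha> d - 1) - 1)
      = (real b ^ min \<alpha> d - real b) * real b powr (real \<alpha> / 2)"
    by (simp add: algebra_simps)
  then show ?thesis by (simp only: phi_def divide_divide_eq_left)
qed

lemma pow_floor_log_eq: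
  assumes "b > 1" "1 / real b ^ Suc i \<le> z" "z < 1 / real b ^ i"
  shows "pow_floor_log b z = 1 / real b ^ Suc i"
proof -
  have "0 < 1 / real b ^ Suc i" using assms by simp
  then have z: "z > 0" using assms(2) by (rule less_le_trans)
  have "real b powr (- real (Suc i)) \<le> z" "z < real b powr (- real i)"
    using assms by (simp_all add: powr_minus powr_realpow divide_inverse del: of_nat_Suc power_Suc)
  then have "- real (Suc i) \<le> log b z" "log b z < - real i"
    using z assms by (simp_all add: le_log_iff log_less_iff del: of_nat_Suc)
  then have "\<lfloor>log b z\<rfloor> = - int (Suc i)" by (simp add: floor_eq_iff)
  then show ?thesis using z by (simp add: pow_floor_log_def power_int_minus divide_inverse del: power_Suc of_nat_Suc)
qed

text \<open>The lower bound keeps only the leading digit. The upper bound replaces all later digits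
  by \<open>b - 1\<close> and telescopes; it is strict because the expansion is finite.\<close>

lemma digit_expansion_bounds:
  fixes t :: "nat \<Rightarrow> int"
  assumes "b > 1" "\<And>i. 0 \<le> t i \<and> t i < int b" "\<And>i. i < i0 \<Longrightarrow> t i = 0" "t i0 \<noteq> 0" "i0 < m"
  defines "z \<equiv> \<Sum>i<m. real_of_int (t i) / real b ^ Suc i"
  shows "1 / real b ^ Suc i0 \<le> z" "z < 1 / real b ^ i0"
proof -
  have "1 / real b ^ Suc i0 \<le> real_of_int (t i0) / real b ^ Suc i0"
    using assms(2)[of i0] assms(4) by (intro divide_right_mono) auto
  also have "\<dots> \<le> z"
    unfolding z_def using assms by (intro member_le_sum) auto
  finally show "1 / real b ^ Suc i0 \<le> z" .
  have "(\<Sum>i<n. real_of_int (t i) / real b ^ Suc i) \<le> 1 / real b ^ i0 - 1 / real b ^ n"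
    if "n \<ge> i0" for n
    using that
  proof (induction n rule: dec_induct)
    case base
    then show ?case using assms(3) by simp
  next
    case (step n)
    have "real_of_int (t n) \<le> real b - 1" using assms(2)[of n] by linarith
    then have "real_of_int (t n) / real b ^ Suc n \<le> (real b - 1) / real b ^ Suc n"
      by (intro divide_right_mono) auto
    also have "\<dots> = 1 / real b ^ n - 1 / real b ^ Suc n"
      using assms(1) by (simp add: field_simps)
    finally show ?case using step by simp
  qed
  from this[of m] have "z \<le> 1 / real b ^ i0 - 1 / real b ^ m"
    using assms(5) by (simp add: z_def)
  moreover have "1 / real b ^ m > 0" using assms(1) by simp
  ultimately show "z < 1 / real b ^ i0" by linarith
qed

text \<open>
  The coefficient of \<open>\<phi>\<close> on the residue class of \<open>k\<close> modulo \<open>x\<^sup>m\<close>: the constant summand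
  collects the Walsh coefficients of index at least \<open>b\<^sup>m\<close>, and \<open>c\<close> stands for \<open>min \<alpha> d\<close>.
\<close>

definition walsh_coeff :: "nat \<Rightarrow> nat \<Rightarrow> nat \<Rightarrow> 'p::prime_card mod_ring poly \<Rightarrow> real" where
  "walsh_coeff \<alpha> c m k =
     ((if k = 0 then 0 else (1 / real CARD('p) ^ c) ^ Suc (degree k)) +
      (real CARD('p) - 1) / (real CARD('p) ^ c - real CARD('p)) / (real CARD('p) ^ c) ^ m) /
     real CARD('p) powr (real \<alpha> / 2)"

lemma card_gt_1: "1 < CARD('p::prime_card)"
  by (rule prime_gt_1_nat[OF prime_card])

lemma card_less_power:
  assumes "c > 1"
  shows "real CARD('p::prime_card) < real CARD('p) ^ c"
  using power_strict_increasing[of 1 c "real CARD('p)"] card_gt_1[where 'p='p] assms by simp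

text \<open>At \<open>k = 0\<close> only the constant tail summand remains, so the trivial character
  has the smallest coefficient, as \<open>minimal_mean_bound\<close> demands.\<close>

lemma walsh_coeff_0_le:
  assumes "c > 1"
  shows "0 \<le> walsh_coeff \<alpha> c m (0 :: 'p::prime_card mod_ring poly)"
    and "walsh_coeff \<alpha> c m (0 :: 'p mod_ring poly) \<le> walsh_coeff \<alpha> c m (k :: 'p mod_ring poly)"
proof -
  show "0 \<le> walsh_coeff \<alpha> c m (0 :: 'p::prime_card mod_ring poly)"
    using card_less_power[OF assms, where 'p='p] card_gt_1[where 'p='p]
    by (simp add: walsh_coeff_def)
  have "0 \<le> (1 / real CARD('p) ^ c) ^ Suc (degree k)" by simp
  then show "walsh_coeff \<alpha> c m (0 :: 'p mod_ring poly) \<le> walsh_coeff \<alpha> c m k"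
    unfolding walsh_coeff_def by (intro divide_right_mono add_right_mono) simp_all
qed

context irreducible_modulus
begin

text \<open>Both sides depend only on the position of the first nonzero digit of the point: the
  character sums over initial segments are \<open>S a\<close>, so summation by degree leaves a
  geometric sum cut off there.\<close>

lemma phi_walsh_expansion:
  assumes c: "min \<alpha> d > 1"
  shows "complex_of_real (phi CARD('p) \<alpha> d (digit_value p g))
    = (\<Sum>k\<in>H. of_real (walsh_coeff \<alpha> (min \<alpha> d) (degree p) k) * residue_char p (k * g))"
proof -
  define b where "b = CARD('p)"
  define x where "x = real b"
  define y where "y = x ^ min \<alpha> d"
  define m where "m = degree p"
  define kap where "kap = x powr (real \<alpha> / 2)"
  define t where "t = (\<lambda>i. residue_coeff p (monom 1 i * g))"
  define S where "S = (\<lambda>a. if \<forall>i<a. t i = 0 then x ^ a else 0)"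
  define T where "T = (\<Sum>a<m. (1 / y) ^ Suc a * (S (Suc a) - S a))"
  have b1: "b > 1" unfolding b_def by (rule card_gt_1)
  have x0: "x > 0" and xy: "x < y"
    using b1 card_less_power[OF c, where 'p='p] by (auto simp: x_def y_def b_def)
  have S: "(\<Sum>k\<in>poly_below a. residue_char p (k * g)) = of_real (S a)" for a
    unfolding sum_residue_char by (simp add: S_def t_def x_def b_def)
  have "(\<Sum>k\<in>poly_below m. of_real (walsh_coeff \<alpha> (min \<alpha> d) m k) * residue_char p (k * g))
    = (\<Sum>k\<in>poly_below m. (if k = 0 then 0 else of_real ((1 / y) ^ Suc (degree k))) *
          residue_char p (k * g)) / of_real kap
      + of_real ((x - 1) / (y - x) / y ^ m) * (\<Sum>k\<in>poly_below m. residue_char p (k * g)) / of_real kap"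
    unfolding sum_distrib_left sum_divide_distrib sum.distrib[symmetric] m_def[symmetric]
    by (intro sum.cong refl)
       (simp add: walsh_coeff_def kap_def x_def y_def b_def add_divide_distrib distrib_right)
  also have "\<dots> = of_real ((T + (x - 1) / (y - x) / y ^ m * S m) / kap)"
    by (subst sum_poly_below_by_degree) (simp add: S T_def add_divide_distrib)
  finally have main: "(\<Sum>k\<in>poly_below m. of_real (walsh_coeff \<alpha> (min \<alpha> d) m k) * residue_char p (k * g))
      = of_real ((T + (x - 1) / (y - x) / y ^ m * S m) / kap)" .
  have dv: "digit_value p g = (\<Sum>i<m. real_of_int (to_int_mod_ring (t i)) / real b ^ Suc i)"
    by (simp add: digit_value_def m_def t_def b_def)
  have phi: "phi b \<alpha> d z = (x - 1 - pow_floor_log b z ^ (min \<alpha> d - 1) * (y - 1)) / (y - x) / kap" for z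
    using phi_eq[OF b1 c] by (simp add: x_def y_def kap_def)
  have T: "T + (x - 1) / (y - x) / y ^ m * S m
      = (x - 1 - pow_floor_log b (digit_value p g) ^ (min \<alpha> d - 1) * (y - 1)) / (y - x)"
  \<comment> \<open>For the point 0, \<open>S m = b ^ m\<close> and the tail summand exactly
    restores the term \<open>(x / y) ^ m\<close> missing from the geometric sum. Otherwise
    \<open>S m = 0\<close> and the tail drops out.\<close>
  proof (cases "\<forall>i<m. t i = 0")
    case True
    then have "T = (\<Sum>a<m. (1 / y) ^ Suc a * (x ^ Suc a - x ^ a))"
      unfolding T_def by (intro sum.cong) (auto simp: S_def)
    then have T: "T = (x - 1) / (y - x) * (1 - (x / y) ^ m)"
      using geometric_digit_sum[OF xy x0] by simp
    have "digit_value p g = 0" using True by (simp add: dv)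
    then have "pow_floor_log b (digit_value p g) ^ (min \<alpha> d - 1) = 0"
      using c by (simp add: pow_floor_log_def)
    then show ?thesis
      using True by (simp add: T S_def power_divide right_diff_distrib)
  next
    case False
    define i where "i = (LEAST i. t i \<noteq> 0)"
    have i: "t i \<noteq> 0" "\<And>j. j < i \<Longrightarrow> t j = 0" "i < m"
    proof -
      show "t i \<noteq> 0" unfolding i_def by (rule LeastI_ex) (use False in auto)
      show "t j = 0" if "j < i" for j using that not_less_Least unfolding i_def by blast
      obtain j where "j < m" "t j \<noteq> 0" using False by auto
      then show "i < m" unfolding i_def using Least_le[of "\<lambda>i. t i \<noteq> 0" j] by linarith
    qed
    have Si: "S a = (if a \<le> i then x ^ a else 0)" for a
      unfolding S_def using i(1,2) by (cases "a \<le> i") auto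
    have T: "T = (x - 1 - (x / y) ^ Suc i * (y - 1)) / (y - x)"
      unfolding T_def Si truncated_digit_sum[OF xy x0] using i by simp
    have rng: "0 \<le> to_int_mod_ring (t j) \<and> to_int_mod_ring (t j) < int b" for j
      using range_to_int_mod_ring[where 'a='p] by (force simp: b_def)
    have pf: "pow_floor_log b (digit_value p g) = 1 / x ^ Suc i"
      unfolding x_def
    proof (rule pow_floor_log_eq[OF b1])
      show "1 / real b ^ Suc i \<le> digit_value p g" "digit_value p g < 1 / real b ^ i"
        unfolding dv by (rule digit_expansion_bounds[OF b1 rng]; use i in simp)+
    qed
    \<comment> \<open>This matches the ratio \<open>x / y\<close> of the geometric sum with the
      power of \<open>pow_floor_log\<close> in \<open>phi\<close>.\<close>
    have "y = x * x ^ (min \<alpha> d - 1)"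
      unfolding y_def using c by (metis gr_implies_not0 power_eq_if)
    then have "x / y = 1 / x ^ (min \<alpha> d - 1)" using x0 by simp
    then have pw: "(1 / x ^ Suc i) ^ (min \<alpha> d - 1) = (x / y) ^ Suc i"
      by (simp only: power_one_over[symmetric] power_mult[symmetric] mult.commute)
    have Sm: "S m = 0" using i by (simp add: Si)
    show ?thesis unfolding T pf pw Sm by simp
  qed
  show ?thesis
    unfolding b_def[symmetric] m_def[symmetric] phi T[symmetric] by (rule main[symmetric])
qed

lemma has_coeffs_phi:
  assumes "min \<alpha> d > 1"
  shows "has_coeffs (\<lambda>g. phi CARD('p) \<alpha> d (digit_value p g)) (walsh_coeff \<alpha> (min \<alpha> d) (degree p))"
  unfolding has_coeffs_def
  using phi_walsh_expansion[OF assms] order_trans[OF walsh_coeff_0_le[OF assms, where 'p='p]] by simp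

end

text \<open>Subadditivity separates the degree-dependent part from the tail. Summed over all
  \<open>k\<close>, they contribute the two entries of the maximum in \<open>G_tilde\<close> with
  weights \<open>1 - (x / Y) ^ m\<close> and \<open>(x / Y) ^ m\<close>, a convex
  combination.\<close>

lemma sum_walsh_coeff_powr_le:
  assumes c: "min \<alpha> d > 1" and lam: "1 / real (min \<alpha> d) < lam" "lam \<le> 1"
  shows "(\<Sum>k\<in>poly_below m. walsh_coeff \<alpha> (min \<alpha> d) m (k :: 'p::prime_card mod_ring poly) powr lam)
    \<le> G_tilde CARD('p) \<alpha> d lam"
proof -
  define b where "b = CARD('p)"
  define x where "x = real b"
  define y where "y = x ^ min \<alpha> d"
  define Y where "Y = x powr (lam * real (min \<alpha> d))"
  define kap where "kap = x powr (real \<alpha> / 2)"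
  define A where "A = ((x - 1) / (y - x)) powr lam"
  define h where "h = (\<lambda>k :: 'p mod_ring poly. if k = 0 then 0 else (1 / y) ^ Suc (degree k))"
  have lam0: "lam > 0"
    using lam(1) by (rule le_less_trans[rotated]) simp
  have b1: "b > 1" unfolding b_def by (rule card_gt_1)
  have x1: "x > 1" and xy: "x < y"
    using b1 card_less_power[OF c, where 'p='p] by (auto simp: x_def y_def b_def)
  have Yy: "Y = y powr lam"
  proof -
    have "y = x powr real (min \<alpha> d)" using x1 by (simp add: y_def powr_realpow)
    then show ?thesis by (simp only: Y_def powr_powr mult.commute)
  qed
  \<comment> \<open>The lower bound on \<open>lam\<close> enters here: it makes the ratio
    \<open>x / Y\<close> less than 1.\<close>
  have "lam * real (min \<alpha> d) > 1" using lam(1) c by (simp add: field_simps)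
  then have xY: "x < Y" using x1 powr_less_mono[of 1 "lam * real (min \<alpha> d)" x] by (simp add: Y_def)
  have hp: "h k powr lam = (if k = 0 then 0 else (1 / Y) ^ Suc (degree k))" for k
  proof -
    have "((1 / y) ^ n) powr lam = (1 / Y) ^ n" for n
      using xy x1 by (induction n) (simp_all add: Yy powr_mult powr_divide)
    then show ?thesis by (simp add: h_def del: power_Suc)
  qed
  have wc: "walsh_coeff \<alpha> (min \<alpha> d) m k = (h k + (x - 1) / (y - x) / y ^ m) / kap"
    for k :: "'p mod_ring poly"
    by (simp add: walsh_coeff_def h_def kap_def x_def y_def b_def)
  have tail: "((x - 1) / (y - x) / y ^ m) powr lam = A / Y ^ m"
  proof -
    have "(y ^ m) powr lam = Y ^ m"
      using xy x1 by (induction m) (simp_all add: Yy powr_mult)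
    then show ?thesis
      unfolding A_def using xy x1 by (subst powr_divide[of "(x - 1) / (y - x)"]) simp_all
  qed
  have "walsh_coeff \<alpha> (min \<alpha> d) m k powr lam \<le> (h k powr lam + A / Y ^ m) / kap powr lam"
    for k :: "'p mod_ring poly"
  proof -
    have "h k \<ge> 0" using xy x1 by (simp add: h_def)
    then have "(h k + (x - 1) / (y - x) / y ^ m) powr lam \<le> h k powr lam + A / Y ^ m"
      unfolding tail[symmetric] using xy x1 lam0 lam(2) by (intro powr_add_le_powr_add_powr) auto
    then show ?thesis
      unfolding wc using xy x1 \<open>h k \<ge> 0\<close>
      by (subst powr_divide) (auto intro!: divide_right_mono add_nonneg_nonneg simp: kap_def)
  qed
  then have "(\<Sum>k\<in>poly_below m. walsh_coeff \<alpha> (min \<alpha> d) m (k :: 'p mod_ring poly) powr lam)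
      \<le> (\<Sum>k\<in>poly_below m. (h k powr lam + A / Y ^ m) / kap powr lam)"
    by (rule sum_mono)
  also have "\<dots> = ((\<Sum>k\<in>poly_below m. h k powr lam * 1) + x ^ m * (A / Y ^ m)) / kap powr lam"
    by (simp add: sum_divide_distrib[symmetric] sum.distrib card_poly_below x_def b_def)
  also have "(\<Sum>k\<in>poly_below m. h k powr lam * 1) = (\<Sum>a<m. (1 / Y) ^ Suc a * (x ^ Suc a - x ^ a))"
    unfolding hp
    by (subst sum_poly_below_by_degree) (simp add: card_poly_below x_def b_def)
  also have "\<dots> = (x - 1) / (Y - x) * (1 - (x / Y) ^ m)"
    using geometric_digit_sum[OF xY] x1 by simp
  also have "((x - 1) / (Y - x) * (1 - (x / Y) ^ m) + x ^ m * (A / Y ^ m)) / kap powr lam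
      = ((1 - (x / Y) ^ m) * ((x - 1) / (Y - x)) + (x / Y) ^ m * A) / kap powr lam"
    by (simp add: power_divide mult.commute)
  also have "\<dots> \<le> max A ((x - 1) / (Y - x)) / kap powr lam"
  proof (rule divide_right_mono)
    have "0 \<le> (x / Y) ^ m" "(x / Y) ^ m \<le> 1" using x1 xY by (auto intro: power_le_one)
    then have "(1 - (x / Y) ^ m) * ((x - 1) / (Y - x)) + (x / Y) ^ m * A
        \<le> (1 - (x / Y) ^ m) * max A ((x - 1) / (Y - x)) + (x / Y) ^ m * max A ((x - 1) / (Y - x))"
      by (intro add_mono mult_left_mono) auto
    then show "(1 - (x / Y) ^ m) * ((x - 1) / (Y - x)) + (x / Y) ^ m * A \<le> max A ((x - 1) / (Y - x))"
      by (simp add: algebra_simps)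
  qed simp
  also have "\<dots> = G_tilde CARD('p) \<alpha> d lam"
    by (simp add: G_tilde_def A_def y_def Y_def x_def b_def kap_def powr_powr)
  finally show ?thesis .
qed

subsection \<open>The component-by-component recursion\<close>

lemma lattice_mean_add: "lattice_mean p (\<lambda>g. F g + G g) = lattice_mean p F + lattice_mean p G"
  by (simp add: lattice_mean_def sum.distrib distrib_left)

lemma lattice_mean_cmult: "lattice_mean p (\<lambda>g. a * F g) = a * lattice_mean p F"
  by (simp add: lattice_mean_def sum_distrib_left mult.left_commute)

lemma sum_Pow_Suc:
  fixes h :: "nat set \<Rightarrow> 'c::comm_monoid_add"
  shows "(\<Sum>v\<in>Pow {1..Suc j} - {{}}. h v)
    = (\<Sum>v\<in>Pow {1..j} - {{}}. h v) + (\<Sum>v\<in>Pow {1..j}. h (v \<union> {Suc j}))"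
proof -
  have "Pow {1..Suc j} - {{}} = (Pow {1..j} - {{}}) \<union> insert (Suc j) ` Pow {1..j}"
    by (auto simp: atLeastAtMostSuc_conv Pow_insert)
  moreover have "inj_on (insert (Suc j)) (Pow {1..j})"
  proof (rule inj_onI)
    fix v w assume "v \<in> Pow {1..j}" "w \<in> Pow {1..j}" "insert (Suc j) v = insert (Suc j) w"
    moreover from this have "Suc j \<notin> v" "Suc j \<notin> w" by auto
    ultimately show "v = w" by (simp add: insert_ident)
  qed
  moreover have "(Pow {1..j} - {{}}) \<inter> insert (Suc j) ` Pow {1..j} = {}" by auto
  ultimately show ?thesis
    by (simp add: sum.union_disjoint sum.reindex)
qed

section \<open>Calculus of power sums of coefficients\<close>

context irreducible_modulus
begin

lemma lattice_mean_nonneg: "has_coeffs F a \<Longrightarrow> lattice_mean p F \<ge> 0"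
  by (metis has_coeffs_def lattice_mean_eq)

text \<open>Needed for the first component, which is fixed to 1 instead of being minimized.\<close>

lemma lattice_mean_dilate:
  assumes "has_coeffs F a" "\<not> p dvd q"
  shows "lattice_mean p (\<lambda>g. F (q * g)) = lattice_mean p F"
proof -
  have "inv_into H (\<lambda>k. (k * q) mod p) ((0 * q) mod p) = 0"
    by (rule inv_into_f_f[OF bij_betw_imp_inj_on[OF bij_betw_mult_mod[OF assms(2)]]])
       (simp add: poly_below_def)
  then show ?thesis
    by (simp add: lattice_mean_eq[OF assms(1)] lattice_mean_eq[OF has_coeffs_dilate[OF assms]])
qed

text \<open>Stated with an upper bound \<open>N\<close> and an existential family, so that it
  composes under sums and products without naming coefficients.\<close>

definition coeff_bound :: "real \<Rightarrow> ('p mod_ring poly \<Rightarrow> real) \<Rightarrow> real \<Rightarrow> bool" where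
  "coeff_bound lam F N \<longleftrightarrow> (\<exists>a. has_coeffs F a \<and> (\<Sum>k\<in>H. a k powr lam) \<le> N)"

lemma coeff_bound_mean_nonneg: "coeff_bound lam F N \<Longrightarrow> lattice_mean p F \<ge> 0"
  by (auto simp: coeff_bound_def intro: lattice_mean_nonneg)

lemma coeff_bound_const:
  assumes "c \<ge> 0"
  shows "coeff_bound lam (\<lambda>g. c) (c powr lam)"
proof -
  have "(\<Sum>k\<in>H. (if k = 0 then c else 0) powr lam) = (\<Sum>k\<in>H. if k = 0 then c powr lam else 0)"
    by (intro sum.cong) auto
  then have "(\<Sum>k\<in>H. (if k = 0 then c else 0) powr lam) \<le> c powr lam"
    by (simp add: poly_below_def)
  then show ?thesis using has_coeffs_const[OF assms] by (auto simp: coeff_bound_def)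
qed

lemma coeff_bound_add:
  assumes "0 < lam" "lam \<le> 1" "coeff_bound lam F N" "coeff_bound lam G K"
  shows "coeff_bound lam (\<lambda>g. F g + G g) (N + K)"
proof -
  obtain a c where a: "has_coeffs F a" "(\<Sum>k\<in>H. a k powr lam) \<le> N"
    and c: "has_coeffs G c" "(\<Sum>k\<in>H. c k powr lam) \<le> K"
    using assms by (auto simp: coeff_bound_def)
  have "(\<Sum>k\<in>H. (a k + c k) powr lam) \<le> (\<Sum>k\<in>H. a k powr lam + c k powr lam)"
    using a(1) c(1) assms(1,2)
    by (intro sum_mono powr_add_le_powr_add_powr) (auto simp: has_coeffs_def)
  also have "\<dots> \<le> N + K" using a(2) c(2) by (simp add: sum.distrib)
  finally show ?thesis using has_coeffs_add[OF a(1) c(1)] by (auto simp: coeff_bound_def)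
qed

text \<open>Subadditivity is applied to each convolution sum; after exchanging the sums, the inner
  one is translation invariant.\<close>

lemma coeff_bound_mult:
  assumes "0 < lam" "lam \<le> 1" "coeff_bound lam F N" "coeff_bound lam G K"
  shows "coeff_bound lam (\<lambda>g. F g * G g) (N * K)"
proof -
  obtain a c where a: "has_coeffs F a" "(\<Sum>k\<in>H. a k powr lam) \<le> N"
    and c: "has_coeffs G c" "(\<Sum>k\<in>H. c k powr lam) \<le> K"
    using assms by (auto simp: coeff_bound_def)
  have a0: "a k \<ge> 0" and c0: "c k \<ge> 0" for k using a(1) c(1) by (auto simp: has_coeffs_def)
  have "(\<Sum>k\<in>H. (\<Sum>l\<in>H. a l * c (k - l)) powr lam) \<le> (\<Sum>k\<in>H. \<Sum>l\<in>H. (a l * c (k - l)) powr lam)"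
    using a0 c0 assms(1,2) by (intro sum_mono powr_sum_le_sum_powr) auto
  also have "\<dots> = (\<Sum>k\<in>H. \<Sum>l\<in>H. a l powr lam * c (k - l) powr lam)"
    using a0 c0 by (simp add: powr_mult)
  also have "\<dots> = (\<Sum>l\<in>H. a l powr lam * (\<Sum>k\<in>H. c (k - l) powr lam))"
    by (subst sum.swap) (simp only: sum_distrib_left)
  also have "\<dots> = (\<Sum>l\<in>H. a l powr lam * (\<Sum>k\<in>H. c k powr lam))"
  proof (rule sum.cong[OF refl])
    fix l assume "l \<in> H"
    from sum_poly_below_shift[OF this, of "\<lambda>k. c (k - l) powr lam"]
    show "a l powr lam * (\<Sum>k\<in>H. c (k - l) powr lam) = a l powr lam * (\<Sum>k\<in>H. c k powr lam)"
      by simp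
  qed
  also have "\<dots> = (\<Sum>l\<in>H. a l powr lam) * (\<Sum>k\<in>H. c k powr lam)"
    by (simp only: sum_distrib_right)
  also have "\<dots> \<le> N * K"
  proof (rule mult_mono[OF a(2) c(2)])
    show "0 \<le> N" by (rule order_trans[OF _ a(2)]) (simp add: sum_nonneg)
  qed (simp add: sum_nonneg)
  finally show ?thesis using has_coeffs_mult[OF a(1) c(1)] by (auto simp: coeff_bound_def)
qed

lemma coeff_bound_sum:
  assumes "0 < lam" "lam \<le> 1" "finite A" "\<And>i. i \<in> A \<Longrightarrow> coeff_bound lam (F i) (N i)"
  shows "coeff_bound lam (\<lambda>g. \<Sum>i\<in>A. F i g) (\<Sum>i\<in>A. N i)"
  using assms(3,4)
proof (induction A rule: finite_induct)
  case empty
  show ?case using coeff_bound_const[of 0 lam] by simp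
next
  case (insert i A)
  then show ?case using coeff_bound_add[OF assms(1,2)] by simp
qed

lemma coeff_bound_prod:
  assumes "0 < lam" "lam \<le> 1" "finite A" "\<And>i. i \<in> A \<Longrightarrow> coeff_bound lam (F i) (N i)"
  shows "coeff_bound lam (\<lambda>g. \<Prod>i\<in>A. F i g) (\<Prod>i\<in>A. N i)"
  using assms(3,4)
proof (induction A rule: finite_induct)
  case empty
  show ?case using coeff_bound_const[of 1 lam] by simp
next
  case (insert i A)
  then show ?case using coeff_bound_mult[OF assms(1,2)] by simp
qed

lemma coeff_bound_phi:
  assumes "min \<alpha> d > 1" "1 / real (min \<alpha> d) < lam" "lam \<le> 1" "\<not> p dvd q"
  shows "coeff_bound lam (\<lambda>g. phi CARD('p) \<alpha> d (digit_value p (q * g))) (G_tilde CARD('p) \<alpha> d lam)"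
proof -
  define f where "f = (\<lambda>k. (k * q) mod p)"
  have bij: "bij_betw f H H" unfolding f_def by (rule bij_betw_mult_mod[OF assms(4)])
  let ?w = "walsh_coeff \<alpha> (min \<alpha> d) (degree p) :: 'p mod_ring poly \<Rightarrow> real"
  have "(\<Sum>k\<in>H. ?w (inv_into H f k) powr lam) = (\<Sum>k\<in>H. ?w k powr lam)"
    by (rule sum.reindex_bij_betw[OF bij_betw_inv_into[OF bij], of "\<lambda>k. ?w k powr lam"])
  then have "(\<Sum>k\<in>H. ?w (inv_into H f k) powr lam) \<le> G_tilde CARD('p) \<alpha> d lam"
    using sum_walsh_coeff_powr_le[OF assms(1-3)] by simp
  then show ?thesis
    using has_coeffs_dilate[OF has_coeffs_phi[OF assms(1)] assms(4)]
    by (auto simp: coeff_bound_def f_def)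
qed

end

section \<open>The criterion and its bound as parallel recursions\<close>

locale cbc_lattice = irreducible_modulus p for p :: "'p::prime_card mod_ring poly" +
  fixes \<alpha> d s :: nat and \<gamma> :: "nat set \<Rightarrow> real" and lam :: real
  assumes min_gt_1: "min \<alpha> d > 1"
    and lam_gt: "1 / real (min \<alpha> d) < lam" and lam_le: "lam \<le> 1"
    and weight_nonneg: "\<And>v. v \<subseteq> {1..s} \<Longrightarrow> \<gamma> v \<ge> 0"
begin

definition phi_value :: "'p mod_ring poly \<Rightarrow> real" where
  "phi_value g = phi CARD('p) \<alpha> d (digit_value p g)"

definition block :: "nat \<Rightarrow> (nat \<Rightarrow> 'p mod_ring poly) \<Rightarrow> nat \<Rightarrow> 'p mod_ring poly \<Rightarrow> real" where
  "block k q j g = -1 + (\<Prod>l=1..k. 1 + phi_value (q ((j - 1) * d + l) * g))"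

definition weight :: "nat set \<Rightarrow> real" where
  "weight = weight_tilde CARD('p) \<alpha> d \<gamma>"

definition tail_sum :: "nat \<Rightarrow> (nat \<Rightarrow> 'p mod_ring poly) \<Rightarrow> 'p mod_ring poly \<Rightarrow> real" where
  "tail_sum j q g = (\<Sum>v\<in>Pow {1..j - 1}. weight (v \<union> {j}) * (\<Prod>i\<in>v. block d q i g))"

definition crit :: "nat \<Rightarrow> nat \<Rightarrow> (nat \<Rightarrow> 'p mod_ring poly) \<Rightarrow> 'p mod_ring poly \<Rightarrow> real" where
  "crit j l q g = (\<Sum>v\<in>Pow {1..j - 1} - {{}}. weight v * (\<Prod>i\<in>v. block d q i g)) +
     tail_sum j q g * block l q j g"

text \<open>The factor with which the next value of \<open>phi\<close> enters the criterion.\<close>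

definition slope :: "nat \<Rightarrow> nat \<Rightarrow> (nat \<Rightarrow> 'p mod_ring poly) \<Rightarrow> 'p mod_ring poly \<Rightarrow> real" where
  "slope j l q g = tail_sum j q g * (1 + block l q j g)"

definition Gt :: real where
  "Gt = G_tilde CARD('p) \<alpha> d lam"

definition Gc :: "nat \<Rightarrow> real" where
  "Gc a = G_const CARD('p) \<alpha> d lam a"

definition tail_bound :: "nat \<Rightarrow> real" where
  "tail_bound j = (\<Sum>v\<in>Pow {1..j - 1}. weight (v \<union> {j}) powr lam * Gc d ^ card v)"

text \<open>The shape of \<open>crit\<close> with weights raised to the power \<open>lam\<close> and
  every block of \<open>k\<close> components replaced by \<open>Gc k\<close>; it thus obeys matching
  recursions in \<open>j\<close> and \<open>l\<close>.\<close>

definition crit_bound :: "nat \<Rightarrow> nat \<Rightarrow> real" where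
  "crit_bound j l = (\<Sum>v\<in>Pow {1..j - 1} - {{}}. weight v powr lam * Gc d ^ card v) + Gc l * tail_bound j"

lemma lam_pos: "0 < lam"
  using lam_gt by (rule le_less_trans[rotated]) simp

lemma weight_fun_nonneg: "v \<subseteq> {1..s} \<Longrightarrow> weight v \<ge> 0"
  by (simp add: weight_def weight_tilde_def weight_nonneg)

lemma Gt_nonneg: "0 \<le> Gt"
  unfolding Gt_def G_tilde_def by (intro mult_nonneg_nonneg max.coboundedI1) auto

lemma Gc_eq: "Gc a = -1 + (1 + Gt) ^ a"
  by (simp add: Gc_def Gt_def G_const_def)

lemma block_0 [simp]: "block 0 q j g = 0"
  by (simp add: block_def)

lemma block_Suc:
  "block (Suc l) q j g = block l q j g + (1 + block l q j g) * phi_value (q ((j - 1) * d + Suc l) * g)"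
  by (simp add: block_def algebra_simps)

lemma crit_Suc_right:
  "crit j (Suc l) q g = crit j l q g + slope j l q g * phi_value (q ((j - 1) * d + Suc l) * g)"
  by (simp add: crit_def slope_def block_Suc algebra_simps)

text \<open>A nonempty subset of \<open>{1..j}\<close> either avoids \<open>j\<close> or contains
  it; the latter give the tail sum times the full block \<open>j\<close>.\<close>

lemma crit_Suc_left:
  assumes "j \<ge> 1"
  shows "crit (Suc j) 0 q g = crit j d q g"
proof -
  obtain i where j: "j = Suc i" using assms by (cases j) auto
  have "weight (v \<union> {Suc i}) * (\<Prod>k\<in>v \<union> {Suc i}. block d q k g)
      = weight (v \<union> {Suc i}) * (\<Prod>k\<in>v. block d q k g) * block d q (Suc i) g"
    if "v \<in> Pow {1..i}" for v
  proof -
    have "finite v" "Suc i \<notin> v" using that finite_subset[of v "{1..i}"] by auto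
    then show ?thesis by (simp add: mult_ac)
  qed
  then have "(\<Sum>v\<in>Pow {1..i}. weight (v \<union> {Suc i}) * (\<Prod>k\<in>v \<union> {Suc i}. block d q k g))
      = tail_sum (Suc i) q g * block d q (Suc i) g"
    unfolding tail_sum_def sum_distrib_right diff_Suc_1 by (rule sum.cong[OF refl])
  then show ?thesis
    unfolding crit_def j diff_Suc_1 sum_Pow_Suc by simp
qed

lemma crit_bound_Suc_right:
  "crit_bound j (Suc l) = crit_bound j l + Gt * (tail_bound j * (1 + Gc l))"
  by (simp add: crit_bound_def Gc_eq algebra_simps)

lemma crit_bound_Suc_left:
  assumes "j \<ge> 1"
  shows "crit_bound (Suc j) 0 = crit_bound j d"
proof -
  obtain i where j: "j = Suc i" using assms by (cases j) auto
  have "weight (v \<union> {Suc i}) powr lam * Gc d ^ card (v \<union> {Suc i})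
      = Gc d * (weight (v \<union> {Suc i}) powr lam * Gc d ^ card v)"
    if "v \<in> Pow {1..i}" for v
  proof -
    have "finite v" "Suc i \<notin> v" using that finite_subset[of v "{1..i}"] by auto
    then show ?thesis by simp
  qed
  then have "(\<Sum>v\<in>Pow {1..i}. weight (v \<union> {Suc i}) powr lam * Gc d ^ card (v \<union> {Suc i}))
      = Gc d * tail_bound (Suc i)"
    unfolding tail_bound_def sum_distrib_left diff_Suc_1 by (rule sum.cong[OF refl])
  then show ?thesis
    unfolding crit_bound_def j diff_Suc_1 sum_Pow_Suc by (simp add: Gc_eq[of 0])
qed

lemma coeff_bound_phi_value: "\<not> p dvd q \<Longrightarrow> coeff_bound lam (\<lambda>g. phi_value (q * g)) Gt"
  unfolding phi_value_def Gt_def by (rule coeff_bound_phi[OF min_gt_1 lam_gt lam_le])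

text \<open>The summand -1 cannot be treated by non-negative expansions, so the induction uses
  \<open>block_Suc\<close>, which has only sums and products; \<open>Gc\<close> satisfies the same
  recursion.\<close>

lemma coeff_bound_block:
  assumes "\<And>l. l \<in> {1..k} \<Longrightarrow> \<not> p dvd q ((j - 1) * d + l)"
  shows "coeff_bound lam (block k q j) (Gc k)"
  using assms
proof (induction k)
  case 0
  show ?case using coeff_bound_const[of 0 lam] by (simp add: Gc_eq block_def)
next
  case (Suc k)
  note add = coeff_bound_add[OF lam_pos lam_le] and mult = coeff_bound_mult[OF lam_pos lam_le]
  have IH: "coeff_bound lam (block k q j) (Gc k)" by (rule Suc.IH) (use Suc.prems in auto)
  have K: "coeff_bound lam (\<lambda>g. phi_value (q ((j - 1) * d + Suc k) * g)) Gt"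
    by (rule coeff_bound_phi_value, rule Suc.prems) simp
  have "coeff_bound lam (\<lambda>g. 1) 1" using coeff_bound_const[of 1 lam] by simp
  from add[OF IH mult[OF add[OF this IH] K]]
  have "coeff_bound lam (block (Suc k) q j) (Gc k + (1 + Gc k) * Gt)"
    by (simp add: block_Suc[abs_def])
  moreover have "Gc k + (1 + Gc k) * Gt = Gc (Suc k)"
    by (simp add: Gc_eq algebra_simps)
  ultimately show ?case by simp
qed

lemma coeff_bound_weighted_blocks:
  assumes "A \<subseteq> Pow {1..i}" "\<And>v. v \<in> A \<Longrightarrow> h v \<ge> 0"
    and "\<And>l. l \<in> {1..i * d} \<Longrightarrow> \<not> p dvd q l"
  shows "coeff_bound lam (\<lambda>g. \<Sum>v\<in>A. h v * (\<Prod>k\<in>v. block d q k g))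
    (\<Sum>v\<in>A. h v powr lam * Gc d ^ card v)"
proof (rule coeff_bound_sum[OF lam_pos lam_le])
  show "finite A" using assms(1) finite_subset by blast
  fix v assume v: "v \<in> A"
  then have vs: "v \<subseteq> {1..i}" using assms(1) by auto
  have "coeff_bound lam (\<lambda>g. \<Prod>k\<in>v. block d q k g) (\<Prod>k\<in>v. Gc d)"
  proof (rule coeff_bound_prod[OF lam_pos lam_le])
    show "finite v" using vs finite_subset by blast
    fix k assume "k \<in> v"
    then have k: "1 \<le> k" "k \<le> i" using vs by auto
    show "coeff_bound lam (block d q k) (Gc d)"
    proof (rule coeff_bound_block)
      fix l assume l: "l \<in> {1..d}"
      have "(k - 1) * d + l \<le> (k - 1) * d + d" using l by simp
      also have "\<dots> = k * d" using k by (simp add: mult_eq_if)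
      also have "\<dots> \<le> i * d" using k by simp
      finally show "\<not> p dvd q ((k - 1) * d + l)" using l by (intro assms(3)) auto
    qed
  qed
  then show "coeff_bound lam (\<lambda>g. h v * (\<Prod>k\<in>v. block d q k g)) (h v powr lam * Gc d ^ card v)"
    using coeff_bound_mult[OF lam_pos lam_le coeff_bound_const[OF assms(2)[OF v]]] by simp
qed

lemma coeff_bound_tail_sum:
  assumes "1 \<le> j" "j \<le> s" "\<And>i. i \<in> {1..(j - 1) * d} \<Longrightarrow> \<not> p dvd q i"
  shows "coeff_bound lam (tail_sum j q) (tail_bound j)"
  unfolding tail_sum_def[abs_def] tail_bound_def
proof (rule coeff_bound_weighted_blocks)
  fix v assume "v \<in> Pow {1..j - 1}"
  then have "v \<union> {j} \<subseteq> {1..s}" using assms(1,2) by fastforce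
  then show "weight (v \<union> {j}) \<ge> 0" by (rule weight_fun_nonneg)
qed (use assms(3) in auto)

lemma coeff_bound_slope:
  assumes "1 \<le> j" "j \<le> s" "\<And>i. i \<in> {1..(j - 1) * d + l} \<Longrightarrow> \<not> p dvd q i"
  shows "coeff_bound lam (slope j l q) (tail_bound j * (1 + Gc l))"
proof -
  have t: "coeff_bound lam (tail_sum j q) (tail_bound j)"
    by (rule coeff_bound_tail_sum) (use assms in auto)
  have b: "coeff_bound lam (block l q j) (Gc l)"
    by (rule coeff_bound_block) (use assms(3) in auto)
  have "coeff_bound lam (\<lambda>g. 1) 1" using coeff_bound_const[of 1 lam] by simp
  from coeff_bound_mult[OF lam_pos lam_le t coeff_bound_add[OF lam_pos lam_le this b]]
  show ?thesis by (simp add: slope_def[abs_def])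
qed

text \<open>The mean is a coefficient, hence non-negative; this permits subadditivity and taking
  roots.\<close>

lemma lattice_mean_crit_nonneg:
  assumes "1 \<le> j" "j \<le> s" "\<And>i. i \<in> {1..(j - 1) * d + l} \<Longrightarrow> \<not> p dvd q i"
  shows "lattice_mean p (crit j l q) \<ge> 0"
proof -
  have t: "coeff_bound lam (tail_sum j q) (tail_bound j)"
    by (rule coeff_bound_tail_sum) (use assms in auto)
  have b: "coeff_bound lam (block l q j) (Gc l)"
    by (rule coeff_bound_block) (use assms(3) in auto)
  have f: "coeff_bound lam (\<lambda>g. \<Sum>v\<in>Pow {1..j - 1} - {{}}. weight v * (\<Prod>i\<in>v. block d q i g))
      (\<Sum>v\<in>Pow {1..j - 1} - {{}}. weight v powr lam * Gc d ^ card v)"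
    by (rule coeff_bound_weighted_blocks) (use assms in \<open>auto intro!: weight_fun_nonneg\<close>)
  show ?thesis
    using coeff_bound_mean_nonneg[OF coeff_bound_add[OF lam_pos lam_le f
        coeff_bound_mult[OF lam_pos lam_le t b]]]
    by (simp add: crit_def[abs_def])
qed

lemma block_cong:
  "(\<And>l. l \<in> {1..k} \<Longrightarrow> q ((j - 1) * d + l) = q' ((j - 1) * d + l)) \<Longrightarrow> block k q j g = block k q' j g"
  by (simp add: block_def)

lemma block_d_cong:
  assumes "\<And>i. i \<in> {1..n * d} \<Longrightarrow> q i = q' i" "1 \<le> k" "k \<le> n"
  shows "block d q k g = block d q' k g"
proof (rule block_cong)
  fix l assume l: "l \<in> {1..d}"
  have "(k - 1) * d + l \<le> (k - 1) * d + d" using l by simp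
  also have "\<dots> = k * d" using assms(2) by (simp add: mult_eq_if)
  also have "\<dots> \<le> n * d" using assms(3) by simp
  finally show "q ((k - 1) * d + l) = q' ((k - 1) * d + l)" using l by (intro assms(1)) auto
qed

lemma tail_sum_cong:
  assumes "\<And>i. i \<in> {1..(j - 1) * d} \<Longrightarrow> q i = q' i"
  shows "tail_sum j q g = tail_sum j q' g"
  unfolding tail_sum_def
  by (intro sum.cong refl arg_cong2[where f = "(*)"] prod.cong block_d_cong[of "j - 1"] assms) auto

text \<open>Changing the component about to be chosen, or any later one, leaves the current
  criterion and slope intact.\<close>

lemma crit_cong:
  assumes "\<And>i. i \<in> {1..(j - 1) * d + l} \<Longrightarrow> q i = q' i"
  shows "crit j l q g = crit j l q' g" "slope j l q g = slope j l q' g"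
proof -
  have t: "tail_sum j q g = tail_sum j q' g" by (rule tail_sum_cong) (use assms in auto)
  have b: "block l q j g = block l q' j g" by (rule block_cong) (use assms in auto)
  have "(\<Sum>v\<in>Pow {1..j - 1} - {{}}. weight v * (\<Prod>i\<in>v. block d q i g))
      = (\<Sum>v\<in>Pow {1..j - 1} - {{}}. weight v * (\<Prod>i\<in>v. block d q' i g))"
    by (intro sum.cong refl arg_cong2[where f = "(*)"] prod.cong block_d_cong[of "j - 1"]) (use assms in auto)
  with t b show "crit j l q g = crit j l q' g" "slope j l q g = slope j l q' g"
    by (simp_all add: crit_def slope_def)
qed

lemma B_crit_eq:
  assumes "j \<ge> 1" "1 \<le> l" "l \<le> d"
  shows "B_crit \<alpha> d \<gamma> ((j - 1) * d + l) q p = lattice_mean p (crit j l q)"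
    and "block_index d ((j - 1) * d + l) = j" and "block_offset d ((j - 1) * d + l) = l"
proof -
  have d: "real d > 0" using assms by simp
  have "\<lceil>real ((j - 1) * d + l) / real d\<rceil> = int j"
  \<comment> \<open>As \<open>l\<close> lies in \<open>{1..d}\<close>, the quotient lies above
    \<open>j - 1\<close> and is at most \<open>j\<close>.\<close>
  proof (rule ceiling_unique)
    have "real ((j - 1) * d + l) = (real j - 1) * real d + real l"
      using assms(1) by (simp add: of_nat_diff)
    then show "of_int (int j) - 1 < real ((j - 1) * d + l) / real d"
      "real ((j - 1) * d + l) / real d \<le> of_int (int j)"
      using assms d by (simp_all add: field_simps)
  qed
  then show bi: "block_index d ((j - 1) * d + l) = j" by (simp add: block_index_def)
  then show bo: "block_offset d ((j - 1) * d + l) = l" by (simp add: block_offset_def)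
  have Phi: "Phi_block \<alpha> d k q p n i = block k q i (poly_of_nat n)" for k n i
    using degree_pos
    by (simp add: Phi_block_def block_def phi_value_def lattice_point_eq_digit_value mult.commute)
  show "B_crit \<alpha> d \<gamma> ((j - 1) * d + l) q p = lattice_mean p (crit j l q)"
    unfolding B_crit_def Let_def bi bo Phi lattice_mean_def crit_def tail_sum_def weight_def
    by (simp add: sum.distrib distrib_left sum_distrib_right)
qed

section \<open>The greedy choice and induction over components\<close>

lemma cbc_in_poly_range:
  assumes "cbc_constructed \<alpha> d s \<gamma> (degree p) p q" "i \<in> {1..d * s}"
  shows "q i \<in> poly_range (degree p)"
proof (cases "i = 1")
  case True
  then show ?thesis using assms degree_pos by (simp add: cbc_constructed_def poly_range_def)
next
  case False
  then show ?thesis using assms by (auto simp: cbc_constructed_def is_arg_min_def)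
qed

text \<open>The criterion is the sum of a mean independent of component \<tau> and the mean compared
  here, so minimizing one minimizes the other.\<close>

lemma cbc_component_minimal:
  assumes cbc: "cbc_constructed \<alpha> d s \<gamma> (degree p) p q"
    and j: "1 \<le> j" "j \<le> s" and l: "l < d" and q': "q' \<in> poly_range (degree p)"
  defines "\<tau> \<equiv> (j - 1) * d + Suc l"
  shows "lattice_mean p (\<lambda>g. slope j l q g * phi_value (q \<tau> * g))
    \<le> lattice_mean p (\<lambda>g. slope j l q g * phi_value (q' * g))"
proof -
  have "\<tau> \<le> (j - 1) * d + d" using l by (simp add: \<tau>_def)
  also have "\<dots> = j * d" using j by (simp add: mult_eq_if)
  also have "\<dots> \<le> d * s" using j by simp
  finally have \<tau>: "\<tau> \<in> {1..d * s}" by (simp add: \<tau>_def)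
  show ?thesis
  proof (cases "\<tau> = 1")
    case True
    \<comment> \<open>The first component is not chosen by minimization, but there the slope is
      constant and the mean of \<open>phi\<close> is dilation invariant, so all candidates
      tie.\<close>
    then have "j = 1" "l = 0" using j l by (auto simp: \<tau>_def)
    then have "slope j l q g = weight {1}" for g
      by (simp add: slope_def tail_sum_def)
    moreover have "lattice_mean p (\<lambda>g. phi_value (r * g)) = lattice_mean p phi_value"
      if "r \<in> poly_range (degree p)" for r
      using lattice_mean_dilate[OF has_coeffs_phi[OF min_gt_1] not_dvd_poly_range[OF that]]
      by (simp add: phi_value_def[abs_def])
    ultimately show ?thesis
      using q' cbc_in_poly_range[OF cbc \<tau>] by (simp add: lattice_mean_cmult)
  next
    case False
    have split: "B_crit \<alpha> d \<gamma> \<tau> (q(\<tau> := r)) p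
        = lattice_mean p (crit j l q) + lattice_mean p (\<lambda>g. slope j l q g * phi_value (r * g))" for r
    proof -
      have crit: "crit j (Suc l) (q(\<tau> := r)) = (\<lambda>g. crit j l q g + slope j l q g * phi_value (r * g))"
      proof
        fix g
        have "crit j l (q(\<tau> := r)) g = crit j l q g" "slope j l (q(\<tau> := r)) g = slope j l q g"
          by (rule crit_cong; simp add: \<tau>_def)+
        then show "crit j (Suc l) (q(\<tau> := r)) g = crit j l q g + slope j l q g * phi_value (r * g)"
          by (simp add: crit_Suc_right \<tau>_def)
      qed
      have "B_crit \<alpha> d \<gamma> \<tau> (q(\<tau> := r)) p = lattice_mean p (crit j (Suc l) (q(\<tau> := r)))"
        unfolding \<tau>_def by (rule B_crit_eq(1)) (use j l in auto)
      then show ?thesis by (simp only: crit lattice_mean_add)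
    qed
    have "\<tau> \<in> {2..d * s}" using False \<tau> by auto
    then have "B_crit \<alpha> d \<gamma> \<tau> (q(\<tau> := q \<tau>)) p \<le> B_crit \<alpha> d \<gamma> \<tau> (q(\<tau> := q')) p"
      using cbc q' unfolding cbc_constructed_def is_arg_min_linorder by blast
    then show ?thesis unfolding split by simp
  qed
qed

text \<open>The increment \<open>t\<close> of the mean is bounded by averaging over all candidates,
  then split off by subadditivity of the power \<open>lam\<close>.\<close>

lemma crit_step_bound:
  assumes cbc: "cbc_constructed \<alpha> d s \<gamma> (degree p) p q"
    and j: "1 \<le> j" "j \<le> s" and l: "l < d"
  defines "M \<equiv> real CARD('p) ^ degree p - 1"
  shows "M * lattice_mean p (crit j (Suc l) q) powr lam
    \<le> M * lattice_mean p (crit j l q) powr lam + Gt * (tail_bound j * (1 + Gc l))"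
proof -
  define \<tau> where "\<tau> = (j - 1) * d + Suc l"
  define t where "t = lattice_mean p (\<lambda>g. slope j l q g * phi_value (q \<tau> * g))"
  have "\<tau> \<le> (j - 1) * d + d" using l by (simp add: \<tau>_def)
  also have "\<dots> = j * d" using j by (simp add: mult_eq_if)
  also have "\<dots> \<le> d * s" using j by simp
  finally have \<tau>: "\<tau> \<le> d * s" .
  have q: "\<not> p dvd q i" if "i \<in> {1..\<tau>}" for i
    using that \<tau> by (intro not_dvd_poly_range cbc_in_poly_range[OF cbc]) auto
  have M0: "M \<ge> 0" unfolding M_def using card_gt_1[where 'p='p] by (simp add: one_le_power)
  have slope: "coeff_bound lam (slope j l q) (tail_bound j * (1 + Gc l))"
    by (rule coeff_bound_slope[OF j], rule q) (auto simp: \<tau>_def)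
  have "coeff_bound lam (\<lambda>g. phi_value (q \<tau> * g)) Gt"
    by (rule coeff_bound_phi_value, rule q) (auto simp: \<tau>_def)
  then have t0: "t \<ge> 0"
    unfolding t_def by (rule coeff_bound_mean_nonneg[OF coeff_bound_mult[OF lam_pos lam_le slope]])
  have c0: "lattice_mean p (crit j l q) \<ge> 0"
    by (rule lattice_mean_crit_nonneg[OF j], rule q) (auto simp: \<tau>_def)
  obtain a where a: "has_coeffs (slope j l q) a" "(\<Sum>k\<in>H. a k powr lam) \<le> tail_bound j * (1 + Gc l)"
    using slope by (auto simp: coeff_bound_def)
  let ?w = "walsh_coeff \<alpha> (min \<alpha> d) (degree p) :: 'p mod_ring poly \<Rightarrow> real"
  have "M * t powr lam \<le> (\<Sum>k\<in>H. ?w k powr lam) * (\<Sum>k\<in>H. a k powr lam)"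
    unfolding M_def
  proof (rule minimal_mean_bound[OF a(1) has_coeffs_phi[OF min_gt_1] _ lam_pos lam_le _ t0])
    fix q' :: "'p mod_ring poly" assume "q' \<in> poly_range (degree p)"
    from cbc_component_minimal[OF cbc j l this]
    show "t \<le> lattice_mean p (\<lambda>g. slope j l q g * phi CARD('p) \<alpha> d (digit_value p (q' * g)))"
      by (simp add: t_def \<tau>_def phi_value_def)
  qed (rule walsh_coeff_0_le(2)[OF min_gt_1])
  also have "\<dots> \<le> Gt * (tail_bound j * (1 + Gc l))"
    using sum_walsh_coeff_powr_le[OF min_gt_1 lam_gt lam_le, where 'p='p] a(2)
    by (intro mult_mono) (auto simp: Gt_def[symmetric] intro!: sum_nonneg Gt_nonneg)
  finally have tb: "M * t powr lam \<le> Gt * (tail_bound j * (1 + Gc l))" .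
  have "lattice_mean p (crit j (Suc l) q) = lattice_mean p (crit j l q) + t"
    by (simp add: crit_Suc_right[abs_def] lattice_mean_add t_def \<tau>_def)
  then have "M * lattice_mean p (crit j (Suc l) q) powr lam
      \<le> M * (lattice_mean p (crit j l q) powr lam + t powr lam)"
    using powr_add_le_powr_add_powr[OF c0 t0 lam_pos lam_le] M0 by (simp add: mult_left_mono)
  with tb show ?thesis by (simp add: distrib_left)
qed

text \<open>The outer induction passes between blocks by identifying \<open>(j + 1, 0)\<close> with
  \<open>(j, d)\<close>; the inner one adds components. At the start both sides are 0.\<close>

lemma crit_bound_cbc:
  assumes cbc: "cbc_constructed \<alpha> d s \<gamma> (degree p) p q" and "1 \<le> j" "j \<le> s" "l \<le> d"
  shows "(real CARD('p) ^ degree p - 1) * lattice_mean p (crit j l q) powr lam \<le> crit_bound j l"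
  using assms(2-)
proof (induction j arbitrary: l rule: dec_induct)
  case base
  then show ?case
  proof (induction l)
    case 0
    show ?case by (simp add: crit_def crit_bound_def lattice_mean_def Gc_eq)
  next
    case (Suc l)
    then show ?case
      using crit_step_bound[OF cbc, of 1 l] by (simp add: crit_bound_Suc_right)
  qed
next
  case (step j)
  from \<open>l \<le> d\<close> show ?case
  proof (induction l)
    case 0
    have "crit (Suc j) 0 q = crit j d q" using crit_Suc_left step by (simp add: fun_eq_iff)
    then show ?case using step by (simp add: crit_bound_Suc_left)
  next
    case (Suc l)
    then show ?case
      using crit_step_bound[OF cbc, of "Suc j" l] step by (simp add: crit_bound_Suc_right)
  qed
qed

lemma B_crit_cbc_bound:
  assumes cbc: "cbc_constructed \<alpha> d s \<gamma> (degree p) p q" and "1 \<le> j" "j \<le> s" "1 \<le> l" "l \<le> d"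
  shows "B_crit \<alpha> d \<gamma> ((j - 1) * d + l) q p
    \<le> 1 / (real CARD('p) ^ degree p - 1) powr (1 / lam) * crit_bound j l powr (1 / lam)"
proof -
  let ?M = "real CARD('p) ^ degree p - 1" and ?X = "lattice_mean p (crit j l q)"
  have M: "?M > 0"
    using card_gt_1[where 'p='p] degree_pos by (simp add: one_less_power)
  have "(j - 1) * d + l \<le> (j - 1) * d + d" using assms by simp
  also have "\<dots> = j * d" using assms by (simp add: mult_eq_if)
  also have "\<dots> \<le> d * s" using assms by simp
  finally have "(j - 1) * d + l \<le> d * s" .
  then have X: "?X \<ge> 0"
    by (intro lattice_mean_crit_nonneg assms not_dvd_poly_range cbc_in_poly_range[OF cbc]) auto
  have "?X powr lam \<le> crit_bound j l / ?M"
    using crit_bound_cbc[OF cbc assms(2,3,5)] M by (simp add: field_simps)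
  then have "(?X powr lam) powr (1 / lam) \<le> (crit_bound j l / ?M) powr (1 / lam)"
    using lam_pos by (intro powr_mono2) auto
  also have "(?X powr lam) powr (1 / lam) = ?X"
    using X lam_pos by (simp add: powr_powr)
  also have "(crit_bound j l / ?M) powr (1 / lam) = 1 / ?M powr (1 / lam) * crit_bound j l powr (1 / lam)"
  proof -
    \<comment> \<open>Non-negativity of \<open>crit_bound j l\<close>, required to split the power
      of the quotient, follows from the bound just proved.\<close>
    have "0 \<le> ?M * ?X powr lam" using M by simp
    also have "\<dots> \<le> crit_bound j l" by (rule crit_bound_cbc[OF cbc assms(2,3,5)])
    finally show ?thesis using M by (simp add: powr_divide)
  qed
  finally show ?thesis using B_crit_eq(1)[OF assms(2,4,5)] by simp
qed

end

theorem theorem4: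
  fixes b s m \<alpha> d \<tau> j0 d0 :: nat
    and \<gamma> :: "nat set \<Rightarrow> real"
    and p :: "'p::prime_card mod_ring poly"
    and q :: "nat \<Rightarrow> 'p mod_ring poly"
    and lam :: real
  assumes "b = CARD('p)"
    and "s \<ge> 1" and "m \<ge> 1"
    and "min \<alpha> d > 1"
    and "\<And>v. v \<subseteq> {1..s} \<Longrightarrow> \<gamma> v \<ge> 0"
    and "cbc_constructed \<alpha> d s \<gamma> m p q"
    and "\<tau> \<in> {1..d * s}"
    and "1 / real (min \<alpha> d) < lam" and "lam \<le> 1"
    and "j0 = block_index d \<tau>" and "d0 = block_offset d \<tau>"
  shows "B_crit \<alpha> d \<gamma> \<tau> q p
    \<le> 1 / (real b ^ m - 1) powr (1 / lam) *
      ((\<Sum>v\<in>Pow {1..j0 - 1} - {{}}.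
          weight_tilde b \<alpha> d \<gamma> v powr lam * G_const b \<alpha> d lam d ^ card v) +
       G_const b \<alpha> d lam d0 *
         (\<Sum>v\<in>Pow {1..j0 - 1}.
            weight_tilde b \<alpha> d \<gamma> (v \<union> {j0}) powr lam * G_const b \<alpha> d lam d ^ card v))
      powr (1 / lam)"
proof -
  have p: "irreducible p" "degree p = m" using assms(6) by (auto simp: cbc_constructed_def)
  interpret cbc_lattice p \<alpha> d s \<gamma> lam
    by unfold_locales (use assms p in auto)
  \<comment> \<open>Dividing \<open>\<tau> - 1\<close> instead of \<tau> puts \<open>l\<close> in
    \<open>{1..d}\<close>, so a full block has \<open>l = d\<close>, in line with the ceiling in
    \<open>block_index\<close>.\<close>
  define j l where "j = (\<tau> - 1) div d + 1" and "l = (\<tau> - 1) mod d + 1"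
  have d: "d > 0" using assms(4) by simp
  have l: "1 \<le> l" "l \<le> d" using d by (auto simp: l_def Suc_le_eq)
  have "(\<tau> - 1) div d < s" using assms(7) d by (intro less_mult_imp_div_less) (auto simp: mult.commute)
  then have j: "1 \<le> j" "j \<le> s" by (auto simp: j_def)
  have \<tau>: "\<tau> = (j - 1) * d + l" using assms(7) by (simp add: j_def l_def)
  have j0: "j0 = j" and d0: "d0 = l"
    using assms(10,11) B_crit_eq(2,3)[OF j(1) l] by (simp_all add: \<tau>)
  have "cbc_constructed \<alpha> d s \<gamma> (degree p) p q" using assms(6) p by simp
  from B_crit_cbc_bound[OF this j l] show ?thesis
    unfolding \<tau>[symmetric] crit_bound_def tail_bound_def weight_def Gc_def p(2) assms(1) j0 d0 .
qed

end
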